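(* Let $m,k\in\mathbb{N}$. Then $$\tau_m\left[x^{m-1+k}\right]=\gamma_m\,\mathrm{GCK}\circ\partial_{x_0}^{m-1}[x_0^{m-1+k}]=\gamma_m\,\frac{(m-1+k)!}{k!}\,Q_k^m(x),$$ where $\gamma_m=\frac{(-1)^{\frac{1-m}{2}}2^{m-1}}{(m-1)!}\Gamma\left(\frac{m+1}{2}\right)^2$ and $$Q_k^m(x)=\sum_{j=0}^kT_j^k(m)\,x^{k-j}\,\overline{x}^{\,j},\qquad T_j^k(m)=\frac{k!}{(m)_k}\,\frac{\left(\frac{m+1}{2}\right)_{k-j}\left(\frac{m-1}{2}\right)_j}{(k-j)!\,j!}.$$
   Context: $\mathbb{R}_m$ is the real Clifford algebra with generators $e_1,\dots,e_m$, $e_je_\ell+e_\ell e_j=-2\delta_{j\ell}$. Points of $\mathbb{R}^{m+1}$ are identified with paravectors $x=x_0+\underline{x}$, $\underline{x}=\sum_{j=1}^m x_je_j$; $\overline{x}=x_0-\underline{x}$, $x\overline{x}=|x|^2$, $x^{-1}=\overline{x}/|x|^2$. $(a)_\ell=\Gamma(a+\ell)/\Gamma(a)=a(a+1)\cdots(a+\ell-1)$ is the Pochhammer symbol (with $(a)_0=1$). $\Delta=\sum_{j=0}^m\partial_{x_j}^2$. Axially monogenic function: real-analytic $F$ with $(\partial_{x_0}+\sum_j e_j\partial_{x_j})F=0$ and $F=A(x_0,|\underline{x}|)+\frac{\underline{x}}{|\underline{x}|}B(x_0,|\underline{x}|)$, $A$ even and $B$ odd in the second variable. $\mathrm{GCK}[f_0]$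 is the unique axially monogenic function of the form $\sum_{j\ge0}\underline{x}^jf_j(x_0)$ ($f_j$ analytic) whose restriction to $\underline{x}=0$ is $f_0(x_0)$. The Fueter-Sce-Qian mapping $\tau_m$ on nonnegative powers. Kelvin inversion: $I[f](x)=\frac{\overline{x}}{|x|^{m+1}}f\left(\frac{\overline{x}}{|x|^2}\right)$. Put $\lambda_m=2^{m-1}\Gamma\left(\frac{m+1}{2}\right)^2$ and, for $n\ge1$, $P^{(-n)}(x)=\frac{(-1)^{n-1}\lambda_m}{(n-1)!}\partial_{x_0}^{n-1}\left[\frac{\overline{x}}{|x|^{m+1}}\right]$ and $P^{(n-1)}=I[P^{(-n)}]$. By definition $\tau_m[x^\ell]=0$ for $0\le\ell\le m-2$ and $\tau_m[x^\ell]=I\left[\Delta^{\frac{m-1}{2}}[x^{-\ell+m-2}]\right]$ for $\ell\ge m-1$, where the (possibly fractional) power of $\Delta$ is given by the Fourier multiplier $(-\Delta)^{\frac{m-1}{2}}=\mathcal{F}^{-1}(2\pi|\cdot|)^{m-1}\mathcal{F}$; it is a known fact that $(-\Delta)^{\frac{m-1}{2}}[x^{-n}]=P^{(-n)}(x)$ for $n\ge1$, and this gives it meaning here, so that $\tau_m[x^\ell]=(-1)^{\frac{1-m}{2}}P^{(\ell+1-m)}(x)$ for $\ell\ge m-1$. Here $(-1)^{\frac{1-m}{2}}$ is one fixed value (e.g. $e^{i\pi(1-m)/2}$), the same throughout. *)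

theory Defs
  imports "HOL-Analysis.Analysis"
begin

section \<open>Clifford algebras\<close>

text \<open>
  The Clifford algebra with one generator \<open>e\<^sub>j\<close> for every \<open>j :: 'n\<close> and
  coefficients in \<open>'k\<close>, subject to \<open>e\<^sub>j e\<^sub>l + e\<^sub>l e\<^sub>j = -2 \<delta>\<^sub>j\<^sub>l\<close>.  An element is its family of
  coefficients with respect to the basis of the \<open>e\<^sub>A = e\<^sub>j\<^sub>1 \<cdots> e\<^sub>j\<^sub>r\<close>, where
  \<open>A = {j\<^sub>1 < \<cdots> < j\<^sub>r}\<close> ranges over the subsets of \<open>'n\<close>.
  With \<open>m = CARD('n)\<close>, the real Clifford algebra on \<open>m\<close> generators is
  \<open>(real, 'n) clifford\<close>, and \<open>(complex, 'n) clifford\<close> is its complexification.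
\<close>

typedef (overloaded) ('k, 'n) clifford = "UNIV :: ('k ^ ('n::finite set)) set"
  morphisms clifford_coeffs Clifford
  by simp

setup_lifting type_definition_clifford

text \<open>
  \<open>e\<^sub>A e\<^sub>B = \<plusminus> e\<^sub>C\<close> with \<open>C\<close> the symmetric difference of \<open>A\<close> and \<open>B\<close>.  Sorting the product into
  increasing order costs a sign for each pair \<open>(i, j) \<in> A \<times> B\<close> with \<open>j < i\<close> (anticommutation)
  and one for each with \<open>j = i\<close> (as \<open>e\<^sub>i\<^sup>2 = -1\<close>).
\<close>

definition clifford_sign :: "'n::{finite,linorder} set \<Rightarrow> 'n set \<Rightarrow> 'k::real_normed_field" where
  "clifford_sign A B = (\<Prod>i\<in>A. \<Prod>j\<in>B. if j \<le> i then -1 else 1)"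

lemma clifford_sign_empty [simp]: "clifford_sign {} B = 1" "clifford_sign A {} = 1"
  by (simp_all add: clifford_sign_def)

lemma prod_sym_diff:
  fixes f :: "'a \<Rightarrow> 'k::comm_ring_1"
  assumes "finite A" "finite B" "\<And>i. f i * f i = 1"
  shows "prod f (sym_diff A B) = prod f A * prod f B"
proof -
  have 1: "prod f A = prod f (A - B) * prod f (A \<inter> B)"
    using assms by (subst prod.union_disjoint [symmetric]) (auto intro: prod.cong)
  have 2: "prod f B = prod f (B - A) * prod f (A \<inter> B)"
    using assms by (subst prod.union_disjoint [symmetric]) (auto intro: prod.cong)
  have 3: "prod f (A \<inter> B) * prod f (A \<inter> B) = 1"
    by (simp add: prod.distrib [symmetric] assms)
  have 4: "prod f (sym_diff A B) = prod f (A - B) * prod f (B - A)"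
    using assms by (subst prod.union_disjoint) auto
  show ?thesis unfolding 1 2 4 using 3 by (metis mult.assoc mult.commute mult.right_neutral)
qed

lemma clifford_sign_sym_diff_left:
  "(clifford_sign (sym_diff A B) C :: 'k::real_normed_field) = clifford_sign A C * clifford_sign B C"
  unfolding clifford_sign_def
  by (rule prod_sym_diff) (auto simp: prod.distrib [symmetric] intro!: prod.neutral)

lemma clifford_sign_sym_diff_right:
  "(clifford_sign A (sym_diff B C) :: 'k::real_normed_field) = clifford_sign A B * clifford_sign A C"
  unfolding clifford_sign_def
  by (subst prod_sym_diff) (auto simp: prod.distrib)

instantiation clifford :: (real_normed_field, finite) real_normed_vector
begin

lift_definition zero_clifford :: "('a, 'b) clifford" is 0 .
lift_definition plus_clifford :: "('a, 'b) clifford \<Rightarrow> ('a, 'b) clifford \<Rightarrow> ('a, 'b) clifford" is "(+)" .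
lift_definition minus_clifford :: "('a, 'b) clifford \<Rightarrow> ('a, 'b) clifford \<Rightarrow> ('a, 'b) clifford" is "(-)" .
lift_definition uminus_clifford :: "('a, 'b) clifford \<Rightarrow> ('a, 'b) clifford" is uminus .
lift_definition scaleR_clifford :: "real \<Rightarrow> ('a, 'b) clifford \<Rightarrow> ('a, 'b) clifford" is scaleR .
lift_definition norm_clifford :: "('a, 'b) clifford \<Rightarrow> real" is norm .

definition dist_clifford :: "('a, 'b) clifford \<Rightarrow> ('a, 'b) clifford \<Rightarrow> real" where
  "dist_clifford a b = norm (a - b)"

definition sgn_clifford :: "('a, 'b) clifford \<Rightarrow> ('a, 'b) clifford" where
  "sgn_clifford a = inverse (norm a) *\<^sub>R a"

definition
  "(uniformity :: (('a, 'b) clifford \<times> ('a, 'b) clifford) filter) =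
     (INF e\<in>{0<..}. principal {(x, y). dist x y < e})"

definition
  "open (U :: ('a, 'b) clifford set) \<longleftrightarrow>
     (\<forall>x\<in>U. \<forall>\<^sub>F (x', y) in uniformity. x' = x \<longrightarrow> y \<in> U)"

instance
  by standard
     (simp_all add: dist_clifford_def sgn_clifford_def uniformity_clifford_def open_clifford_def,
      (transfer; simp add: algebra_simps norm_triangle_ineq)+)

end

instantiation clifford :: (real_normed_field, "{finite,linorder}") real_algebra_1
begin

lift_definition one_clifford :: "('a, 'b) clifford" is
  "\<chi> A. if A = {} then 1 else 0" .

lift_definition times_clifford :: "('a, 'b) clifford \<Rightarrow> ('a, 'b) clifford \<Rightarrow> ('a, 'b) clifford" is
  "\<lambda>a b. \<chi> C. \<Sum>A\<in>UNIV. clifford_sign A (sym_diff A C) * (a $ A) * (b $ sym_diff A C)" .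

instance
proof
  fix a b c :: "('a, 'b) clifford" and r :: real
  have sd1: "sym_diff A (sym_diff A B) = B" for A B :: "'b set" by auto
  have sd2: "sym_diff (sym_diff A B) D = sym_diff B (sym_diff A D)" for A B D :: "'b set" by auto
  show "a * b * c = a * (b * c)"
  proof (transfer, simp add: vec_eq_iff, intro allI)
    fix a b c :: "'a ^ 'b set" and D :: "'b set"
    let ?s = "clifford_sign :: 'b set \<Rightarrow> 'b set \<Rightarrow> 'a"
    have key: "?s (sym_diff A B) (sym_diff B (sym_diff A D)) * ?s A B =
               ?s A (sym_diff A D) * ?s B (sym_diff B (sym_diff A D))" for A B
    proof -
      define Y where "Y = sym_diff B (sym_diff A D)"
      have "sym_diff A D = sym_diff B Y" by (auto simp: Y_def)
      then show ?thesis
        unfolding Y_def [symmetric]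
        by (simp only: clifford_sign_sym_diff_left clifford_sign_sym_diff_right mult_ac)
    qed
    have "(\<Sum>X\<in>UNIV. ?s X (sym_diff X D) *
             (\<Sum>A\<in>UNIV. ?s A (sym_diff A X) * a $ A * b $ sym_diff A X) * c $ sym_diff X D) =
          (\<Sum>A\<in>UNIV. \<Sum>X\<in>UNIV. ?s X (sym_diff X D) *
             (?s A (sym_diff A X) * a $ A * b $ sym_diff A X) * c $ sym_diff X D)"
      by (subst sum.swap) (simp add: sum_distrib_left sum_distrib_right)
    also have "\<dots> = (\<Sum>A\<in>UNIV. \<Sum>B\<in>UNIV. ?s (sym_diff A B) (sym_diff (sym_diff A B) D) *
             (?s A (sym_diff A (sym_diff A B)) * a $ A * b $ sym_diff A (sym_diff A B))
               * c $ sym_diff (sym_diff A B) D)"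
    proof (rule sum.cong [OF refl])
      fix A :: "'b set"
      show "(\<Sum>X\<in>UNIV. ?s X (sym_diff X D) *
             (?s A (sym_diff A X) * a $ A * b $ sym_diff A X) * c $ sym_diff X D) =
            (\<Sum>B\<in>UNIV. ?s (sym_diff A B) (sym_diff (sym_diff A B) D) *
             (?s A (sym_diff A (sym_diff A B)) * a $ A * b $ sym_diff A (sym_diff A B))
               * c $ sym_diff (sym_diff A B) D)"
        by (rule sum.reindex_bij_witness [where i = "sym_diff A" and j = "sym_diff A"])
           (simp_all only: sd1 UNIV_I)
    qed
    also have "\<dots> = (\<Sum>A\<in>UNIV. \<Sum>B\<in>UNIV. (?s (sym_diff A B) (sym_diff B (sym_diff A D)) * ?s A B) *
             (a $ A * b $ B * c $ sym_diff B (sym_diff A D)))"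
      by (simp only: sd1 sd2 mult_ac)
    also have "\<dots> = (\<Sum>A\<in>UNIV. ?s A (sym_diff A D) * a $ A *
             (\<Sum>B\<in>UNIV. ?s B (sym_diff B (sym_diff A D)) * b $ B * c $ sym_diff B (sym_diff A D)))"
      unfolding key sum_distrib_left by (simp only: mult_ac)
    finally show "(\<Sum>X\<in>UNIV. ?s X (sym_diff X D) *
             (\<Sum>A\<in>UNIV. ?s A (sym_diff A X) * a $ A * b $ sym_diff A X) * c $ sym_diff X D) =
           (\<Sum>A\<in>UNIV. ?s A (sym_diff A D) * a $ A *
             (\<Sum>B\<in>UNIV. ?s B (sym_diff B (sym_diff A D)) * b $ B * c $ sym_diff B (sym_diff A D)))" .
  qed
  show "1 * a = a"
    by (transfer, simp add: vec_eq_iff if_distrib [of "\<lambda>x. x * _"] if_distrib [of "\<lambda>x. _ * x"] cong: if_cong)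
  show "a * 1 = a"
  proof (transfer, simp add: vec_eq_iff, intro allI)
    fix a :: "'a ^ 'b set" and C :: "'b set"
    have "(\<Sum>A\<in>UNIV. clifford_sign A (sym_diff A C) * a $ A * (if A \<subseteq> C \<and> C \<subseteq> A then 1 else 0)) =
          (\<Sum>A\<in>UNIV. if A = C then a $ A else 0)"
      by (intro sum.cong) auto
    then show "(\<Sum>A\<in>UNIV. clifford_sign A (sym_diff A C) * a $ A * (if A \<subseteq> C \<and> C \<subseteq> A then 1 else 0)) = a $ C"
      by simp
  qed
  show "(a + b) * c = a * c + b * c"
    by (transfer, simp add: vec_eq_iff algebra_simps sum.distrib)
  show "a * (b + c) = a * b + a * c"
    by (transfer, simp add: vec_eq_iff algebra_simps sum.distrib)
  show "(0::('a, 'b) clifford) \<noteq> 1"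
    by (transfer, auto simp: vec_eq_iff)
  show "r *\<^sub>R a * b = r *\<^sub>R (a * b)"
    by (transfer, simp add: vec_eq_iff scaleR_sum_right)
  show "a * r *\<^sub>R b = r *\<^sub>R (a * b)"
    by (transfer, simp add: vec_eq_iff scaleR_sum_right)
qed

end

lift_definition clifford_basis :: "'n set \<Rightarrow> ('k::real_normed_field, 'n::{finite,linorder}) clifford" is
  "\<lambda>A. axis A 1" .

abbreviation clifford_gen :: "'n \<Rightarrow> ('k::real_normed_field, 'n::{finite,linorder}) clifford" where
  "clifford_gen j \<equiv> clifford_basis {j}"

lift_definition clifford_scale ::
    "'k::real_normed_field \<Rightarrow> ('k, 'n::finite) clifford \<Rightarrow> ('k, 'n) clifford" (infixr "*\<^sub>K" 75) is
  "\<lambda>c a. \<chi> A. c * a $ A" .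

lift_definition complexify :: "(real, 'n::finite) clifford \<Rightarrow> (complex, 'n) clifford" is
  "\<lambda>a. \<chi> A. complex_of_real (a $ A)" .

lemma clifford_basis_mult:
  "clifford_basis A * clifford_basis B =
     (clifford_sign A B *\<^sub>K clifford_basis (sym_diff A B) :: ('k::real_normed_field, 'n::{finite,linorder}) clifford)"
proof (transfer, simp only: vec_eq_iff vec_lambda_beta, intro allI)
  fix A B C :: "'n set"
  have *: "B = sym_diff A C \<longleftrightarrow> C = sym_diff A B" by auto
  have "(\<Sum>D\<in>UNIV. clifford_sign D (sym_diff D C) * (axis A (1::'k)) $ D * axis B 1 $ sym_diff D C) =
        (\<Sum>D\<in>UNIV. if D = A then clifford_sign A (sym_diff A C) * axis B 1 $ sym_diff A C else 0)"
    by (intro sum.cong) (simp_all only: axis_def vec_lambda_beta split: if_splits, simp_all)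
  also have "\<dots> = clifford_sign A B * axis (sym_diff A B) 1 $ C"
    using * by (cases "B = sym_diff A C") (auto simp: axis_def)
  finally show "(\<Sum>D\<in>UNIV. clifford_sign D (sym_diff D C) * (axis A (1::'k)) $ D * axis B 1 $ sym_diff D C) =
      clifford_sign A B * axis (sym_diff A B) 1 $ C" .
qed

lemma clifford_gen_anticommute:
  "clifford_gen j * clifford_gen l + clifford_gen l * clifford_gen j =
     (if j = l then -2 else 0 :: ('k::real_normed_field, 'n::{finite,linorder}) clifford)"
proof -
  have neg: "(-1) *\<^sub>K a = - a" and one: "1 *\<^sub>K a = a" for a :: "('k, 'n) clifford"
    by (transfer, simp add: vec_eq_iff)+
  have e: "clifford_basis {} = (1 :: ('k, 'n) clifford)"
    by transfer (auto simp: axis_def vec_eq_iff)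
  have sd: "sym_diff {l} {j} = sym_diff {j} {l}" by auto
  show ?thesis
  proof (cases j l rule: linorder_cases)
    case less
    then have "j \<noteq> l" "j \<le> l" "\<not> l \<le> j" by auto
    then show ?thesis
      unfolding clifford_basis_mult sd by (simp add: clifford_sign_def neg one)
  next
    case equal
    then show ?thesis
      by (simp add: clifford_basis_mult clifford_sign_def neg e)
  next
    case greater
    then have "j \<noteq> l" "l \<le> j" "\<not> j \<le> l" by auto
    then show ?thesis
      unfolding clifford_basis_mult sd by (simp add: clifford_sign_def neg one)
  qed
qed

lemma clifford_basis_insert:
  assumes "\<And>i. i \<in> A \<Longrightarrow> j < i"
  shows "clifford_basis (insert j A) =
           (clifford_gen j * clifford_basis A :: ('k::real_normed_field, 'n::{finite,linorder}) clifford)"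
proof -
  have "sym_diff {j} A = insert j A" using assms by auto
  moreover have "clifford_sign {j} A = (1::'k)"
    using assms by (auto simp: clifford_sign_def not_le intro!: prod.neutral)
  moreover have "1 *\<^sub>K a = a" for a :: "('k, 'n) clifford"
    by (transfer, simp add: vec_eq_iff)
  ultimately show ?thesis by (simp add: clifford_basis_mult)
qed


section \<open>Paravectors\<close>

text \<open>The point \<open>(x\<^sub>0, v)\<close> is identified with the paravector \<open>x\<^sub>0 + \<Sum>\<^sub>j v\<^sub>j e\<^sub>j\<close>.\<close>

type_synonym 'n point = "real \<times> (real ^ 'n)"

definition paravector :: "'n::{finite,linorder} point \<Rightarrow> ('k::real_normed_field, 'n) clifford" where
  "paravector x = of_real (fst x) + (\<Sum>j\<in>UNIV. (snd x $ j) *\<^sub>R clifford_gen j)"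

definition vec_part :: "'n::finite point \<Rightarrow> 'n point" where
  "vec_part x = (0, snd x)"

definition conj_point :: "'n::finite point \<Rightarrow> 'n point" where
  "conj_point x = (fst x, - snd x)"

definition inv_point :: "'n::finite point \<Rightarrow> 'n point" where
  "inv_point x = (1 / (norm x)\<^sup>2) *\<^sub>R conj_point x"

lemma paravector_mult_conj:
  "paravector x * paravector (conj_point x) =
     (of_real ((norm x)\<^sup>2) :: ('k::real_normed_field, 'n::{finite,linorder}) clifford)"
proof -
  define v :: "('k, 'n) clifford" where "v = (\<Sum>j\<in>UNIV. (snd x $ j) *\<^sub>R clifford_gen j)"
  let ?e = "\<lambda>j. clifford_gen j :: ('k, 'n) clifford"
  have vv: "v * v = (\<Sum>j\<in>UNIV. \<Sum>l\<in>UNIV. (snd x $ j * snd x $ l) *\<^sub>R (?e j * ?e l))"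
    by (simp add: v_def sum_product mult.commute)
  have vv': "v * v = (\<Sum>j\<in>UNIV. \<Sum>l\<in>UNIV. (snd x $ l * snd x $ j) *\<^sub>R (?e l * ?e j))"
    unfolding vv by (rule sum.swap)
  have "2 *\<^sub>R (v * v) = v * v + v * v" by (simp add: scaleR_2)
  also have "\<dots> = (\<Sum>j\<in>UNIV. \<Sum>l\<in>UNIV. (snd x $ j * snd x $ l) *\<^sub>R (?e j * ?e l) +
                     (snd x $ l * snd x $ j) *\<^sub>R (?e l * ?e j))"
    unfolding sum.distrib by (rule arg_cong2 [where f = "(+)", OF vv vv'])
  also have "\<dots> = (\<Sum>j\<in>UNIV. \<Sum>l\<in>UNIV. (snd x $ j * snd x $ l) *\<^sub>R (?e j * ?e l + ?e l * ?e j))"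
    by (simp add: scaleR_add_right mult.commute)
  also have "\<dots> = (\<Sum>j\<in>UNIV. (snd x $ j * snd x $ j) *\<^sub>R (-2))"
    by (simp only: clifford_gen_anticommute if_distrib [of "\<lambda>a. _ *\<^sub>R a"] scaleR_zero_right
                   sum.delta' finite UNIV_I if_True)
  also have "\<dots> = 2 *\<^sub>R (- of_real ((norm (snd x))\<^sup>2))"
    unfolding power2_norm_eq_inner inner_vec_def
    by (simp add: scaleR_conv_of_real sum_negf [symmetric] sum_distrib_left mult_2 mult_2_right)
  finally have v2: "v * v = - of_real ((norm (snd x))\<^sup>2)"
    by (simp only: scaleR_cancel_left) simp
  have n: "(norm x)\<^sup>2 = (fst x)\<^sup>2 + (norm (snd x))\<^sup>2"
    by (simp add: norm_prod_def)
  have p: "paravector x = of_real (fst x) + v" "paravector (conj_point x) = of_real (fst x) - v"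
    by (simp_all add: paravector_def conj_point_def v_def sum_negf)
  have "of_real (fst x) * v = v * of_real (fst x)"
    by (metis of_real_def mult_scaleR_left mult_scaleR_right mult_1 mult_1_right)
  then have "(of_real (fst x) + v) * (of_real (fst x) - v) = of_real (fst x) * of_real (fst x) - v * v"
    by (simp add: algebra_simps)
  then show ?thesis
    unfolding p n v2 by (simp add: power2_eq_square)
qed


section \<open>Axially monogenic functions and the generalized CK extension\<close>

definition real_analytic :: "('a::euclidean_space \<Rightarrow> 'b::real_normed_vector) \<Rightarrow> bool" where
  "real_analytic F \<longleftrightarrow> (\<forall>p. \<exists>r>0. \<exists>c :: ('a \<Rightarrow> nat) \<Rightarrow> 'b. \<forall>x\<in>ball p r.
     ((\<lambda>\<alpha>. (\<Prod>b\<in>Basis. ((x - p) \<bullet> b) ^ \<alpha> b) *\<^sub>R c \<alpha>) has_sum F x) (Basis \<rightarrow>\<^sub>E UNIV))"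

definition partial_deriv ::
    "'a::real_normed_vector \<Rightarrow> ('a \<Rightarrow> 'b::real_normed_vector) \<Rightarrow> 'a \<Rightarrow> 'b" where
  "partial_deriv b F x = vector_derivative (\<lambda>t. F (x + t *\<^sub>R b)) (at 0)"

abbreviation partial_x0 ::
    "('n::finite point \<Rightarrow> 'b::real_normed_vector) \<Rightarrow> 'n point \<Rightarrow> 'b" where
  "partial_x0 \<equiv> partial_deriv (1, 0)"

abbreviation deriv_op :: "(real \<Rightarrow> 'b::real_normed_vector) \<Rightarrow> real \<Rightarrow> 'b" where
  "deriv_op f \<equiv> (\<lambda>t. vector_derivative f (at t))"

definition monogenic :: "('n::{finite,linorder} point \<Rightarrow> (real, 'n) clifford) \<Rightarrow> bool" where
  "monogenic F \<longleftrightarrow>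
     (\<forall>x. partial_x0 F x + (\<Sum>j\<in>UNIV. clifford_gen j * partial_deriv (0, axis j 1) F x) = 0)"

text \<open>
  On the real axis the unit vector below is \<open>0 / 0 = 0\<close>; this is harmless, since
  \<open>B x\<^sub>0 0 = 0\<close> by oddness.
\<close>

definition axial_form :: "('n::{finite,linorder} point \<Rightarrow> (real, 'n) clifford) \<Rightarrow> bool" where
  "axial_form F \<longleftrightarrow> (\<exists>A B :: real \<Rightarrow> real \<Rightarrow> (real, 'n) clifford.
     (\<forall>s r. A s (- r) = A s r) \<and> (\<forall>s r. B s (- r) = - B s r) \<and>
     (\<forall>x. F x = A (fst x) (norm (snd x)) +
                (1 / norm (snd x)) *\<^sub>R paravector (vec_part x) * B (fst x) (norm (snd x))))"

definition axially_monogenic :: "('n::{finite,linorder} point \<Rightarrow> (real, 'n) clifford) \<Rightarrow> bool" where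
  "axially_monogenic F \<longleftrightarrow> real_analytic F \<and> monogenic F \<and> axial_form F"

text \<open>
  The extension is taken on the whole space, which suffices for polynomial initial functions
  \<open>f\<^sub>0\<close> on the real line.
\<close>

definition GCK :: "(real \<Rightarrow> (real, 'n::{finite,linorder}) clifford) \<Rightarrow> 'n point \<Rightarrow> (real, 'n) clifford" where
  "GCK f\<^sub>0 = (THE F. axially_monogenic F \<and>
     (\<exists>f :: nat \<Rightarrow> real \<Rightarrow> (real, 'n) clifford. (\<forall>j. real_analytic (f j)) \<and>
        (\<forall>x. (\<lambda>j. paravector (vec_part x) ^ j * f j (fst x)) sums F x)) \<and>
     (\<forall>s. F (s, 0) = f\<^sub>0 s))"


section \<open>The Fueter-Sce-Qian mapping on nonnegative powers\<close>

definition kelvin ::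
    "('n::{finite,linorder} point \<Rightarrow> ('k::real_normed_field, 'n) clifford) \<Rightarrow> 'n point \<Rightarrow> ('k, 'n) clifford" where
  "kelvin f x = (1 / norm x ^ (CARD('n) + 1)) *\<^sub>R paravector (conj_point x) * f (inv_point x)"

definition lambda_const :: "nat \<Rightarrow> real" where
  "lambda_const m = 2 ^ (m - 1) * (Gamma ((real m + 1) / 2))\<^sup>2"

text \<open>\<open>P_neg n\<close> is \<open>P\<^bsup>(-n)\<^esup>\<close>, for \<open>n \<ge> 1\<close>.\<close>

definition P_neg :: "nat \<Rightarrow> 'n::{finite,linorder} point \<Rightarrow> (real, 'n) clifford" where
  "P_neg n x = ((-1) ^ (n - 1) * lambda_const CARD('n) / fact (n - 1)) *\<^sub>R
     (partial_x0 ^^ (n - 1))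
       (\<lambda>y. (1 / norm y ^ (CARD('n) + 1)) *\<^sub>R paravector (conj_point y)) x"

text \<open>
  The value of \<open>(-1)\<^bsup>(1-m)/2\<^esup>\<close> is \<open>exp (i \<pi> (1 - m) / 2)\<close>, the principal one.
\<close>

definition sign_const :: "nat \<Rightarrow> complex" where
  "sign_const m = (-1) powr ((1 - of_nat m) / 2)"

text \<open>
  \<open>\<Delta>\<^bsup>(m-1)/2\<^esup> [x\<^bsup>-n\<^esup>]\<close> for \<open>n \<ge> 1\<close>.  The Fourier multiplier is not applicable to \<open>x\<^bsup>-n\<^esup>\<close>
  directly when \<open>n\<close> is large; its meaning is fixed by \<open>(-\<Delta>)\<^bsup>(m-1)/2\<^esup> [x\<^bsup>-n\<^esup>] = P\<^bsup>(-n)\<^esup>\<close>.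
\<close>

definition frac_Laplace_inv_power :: "nat \<Rightarrow> 'n::{finite,linorder} point \<Rightarrow> (complex, 'n) clifford" where
  "frac_Laplace_inv_power n x = sign_const CARD('n) *\<^sub>K complexify (P_neg n x)"

text \<open>
  \<open>FSQ l\<close> is \<open>\<tau>\<^sub>m [x\<^sup>l]\<close>.  The Kelvin inversion leaves a removable singularity at the
  origin, where the value is defined by continuity.
\<close>

definition FSQ :: "nat \<Rightarrow> 'n::{finite,linorder} point \<Rightarrow> (complex, 'n) clifford" where
  "FSQ l = (if l < CARD('n) - 1 then (\<lambda>x. 0)
            else let g = kelvin (frac_Laplace_inv_power (l + 2 - CARD('n)))
                 in g(0 := Lim (at 0) g))"


section \<open>The polynomials \<open>Q\<^sub>k\<^sup>m\<close>\<close>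

definition T_coeff :: "nat \<Rightarrow> nat \<Rightarrow> nat \<Rightarrow> real" where
  "T_coeff m k j = fact k / pochhammer (real m) k *
     (pochhammer ((real m + 1) / 2) (k - j) * pochhammer ((real m - 1) / 2) j) /
     (fact (k - j) * fact j)"

definition Q_poly :: "nat \<Rightarrow> 'n::{finite,linorder} point \<Rightarrow> (real, 'n) clifford" where
  "Q_poly k x = (\<Sum>j=0..k. T_coeff CARD('n) k j *\<^sub>R
     (paravector x ^ (k - j) * paravector (conj_point x) ^ j))"

definition gamma_const :: "nat \<Rightarrow> complex" where
  "gamma_const m = sign_const m * 2 ^ (m - 1) / fact (m - 1) *
     (of_real (Gamma ((real m + 1) / 2)))\<^sup>2"

end

theory Submission
  imports Defs
begin

text \<open>
  Write \<open>m\<close> for the number of generators, \<open>v\<close> for the vector part of a paravector \<open>x = s + v\<close>, and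
  \<open>a = (m + 1) / 2\<close>, \<open>b = (m - 1) / 2\<close>, so that \<open>a = b + 1\<close> and \<open>a + b = m\<close>.  Both sides of the
  statement are shown to be multiples of the polynomial \<open>Q\<^sub>k\<close>, whose coefficients are, up to the factor
  \<open>1 / (m)\<^sub>k\<close>, the numbers \<open>c\<^sub>j = binomial(k, j) (a)\<^sub>k\<^sub>-\<^sub>j (b)\<^sub>j\<close>.

  \<^emph>\<open>The image under the Fueter-Sce-Qian map.\<close>  The kernel is \<open>conj(x) / |x|^(m+1) = x^(-a) conj(x)^(-b)\<close>, read
  in the commutative plane that contains \<open>x\<close>.  Each of the two factors is a power of \<open>s + const\<close> in that
  plane, so the Leibniz rule gives
  \<open>\<partial>\<^sub>s\<^sup>k = (-1)\<^sup>k \<Sum>\<^sub>j c\<^sub>j x^(-a-(k-j)) conj(x)^(-b-j)\<close>.  The Kelvin inversion replaces \<open>x\<close> by its inverse and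
  cancels the kernel, which leaves \<open>\<Sum>\<^sub>j c\<^sub>j x^(k-j) conj(x)^j = (m)\<^sub>k Q\<^sub>k\<close>
  (\<open>higher_partial_x0_cauchy_kernel\<close>, \<open>kelvin_P_neg\<close>).  In particular the singularity at the origin is
  removable, and its value is the limit of a polynomial.

  \<^emph>\<open>Existence of the extension.\<close>  The Cauchy-Riemann operator maps \<open>f(s) v^i\<close> to
  \<open>f'(s) v^i - w\<^sub>i f(s) v^(i-1)\<close>, where \<open>w\<^sub>i\<close> is \<open>i\<close> for even \<open>i\<close> and \<open>i + m - 1\<close> for odd \<open>i\<close>.  Hence
  \<open>\<Sum>\<^sub>i \<kappa>\<^sub>i s^(k-i) v^i\<close> is monogenic as soon as \<open>(k - i) \<kappa>\<^sub>i = w\<^sub>i\<^sub>+\<^sub>1 \<kappa>\<^sub>i\<^sub>+\<^sub>1\<close>.  For \<open>Q\<^sub>k\<close> the \<open>\<kappa>\<^sub>i\<close> are the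
  coefficients of \<open>q(X) = \<Sum>\<^sub>j c\<^sub>j (1 + X)^(k-j) (1 - X)^j\<close> divided by \<open>(m)\<^sub>k\<close>, and the recursion is
  the functional equation \<open>X (k q - (1 + X) q') = b (q(X) - q(-X))\<close>, which amounts to
  a linear relation between the \<open>c\<^sub>j\<close> (\<open>axial_poly_functional_equation\<close>).  The value on the real axis
  comes from \<open>\<Sum>\<^sub>j c\<^sub>j = (a + b)\<^sub>k = (m)\<^sub>k\<close>.

  \<^emph>\<open>Uniqueness of the extension.\<close>  Let \<open>F = \<Sum>\<^sub>j v^j f\<^sub>j(s)\<close>, fix a generator \<open>e\<close>, and restrict \<open>F\<close> to the plane of
  the points \<open>s + t e\<close>.  An axial function is determined by its values there, and its
  tangential derivatives can be read off, so that monogenicity becomes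
  \<open>\<partial>\<^sub>s F + e \<partial>\<^sub>t F + (m - 1) / (2 t) e (F(s + t e) - F(s - t e)) = 0\<close> for \<open>t > 0\<close>.  Since \<open>F\<close> is jointly
  real-analytic, its expansion in powers of \<open>t\<close> may be differentiated termwise in \<open>s\<close>.  Comparing
  coefficients gives \<open>w\<^sub>j\<^sub>+\<^sub>1 e^j f\<^sub>j\<^sub>+\<^sub>1 = (e^j f\<^sub>j)'\<close>, so \<open>f\<^sub>0\<close> determines all \<open>f\<^sub>j\<close>, hence \<open>F\<close>
  (\<open>gck_coefficient_recursion\<close>, \<open>gck_extension_unique\<close>).
\<close>

section \<open>The Clifford algebra as a finite-dimensional normed space\<close>

lift_definition clifford_coeff :: "'n set \<Rightarrow> (real, 'n::finite) clifford \<Rightarrow> real" is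
  "\<lambda>C a. a $ C" .

lemma bounded_linear_clifford_coeff: "bounded_linear (clifford_coeff C)"
  by (rule bounded_linear_intro [where K = 1])
     (transfer; simp add: Finite_Cartesian_Product.norm_nth_le component_le_norm_cart)+

lemma linear_clifford_coeff: "linear (clifford_coeff C)"
  by (rule bounded_linear.linear [OF bounded_linear_clifford_coeff])

lemmas clifford_coeff_linear =
  linear_0 [OF linear_clifford_coeff] linear_add [OF linear_clifford_coeff]
  linear_diff [OF linear_clifford_coeff] linear_scale [OF linear_clifford_coeff]
  linear_sum [OF linear_clifford_coeff]

lemma clifford_coeff_basis: "clifford_coeff C (clifford_basis A) = (if A = C then 1 else 0)"
  by transfer (simp add: axis_def)

lemma clifford_eqI:
  "(\<And>C. clifford_coeff C a = clifford_coeff C b) \<Longrightarrow> a = (b :: (real, 'n::finite) clifford)"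
  by transfer (simp add: vec_eq_iff)

lemma clifford_expansion:
  "a = (\<Sum>C\<in>UNIV. clifford_coeff C a *\<^sub>R (clifford_basis C :: (real, 'n::{finite,linorder}) clifford))"
  by (rule clifford_eqI)
     (simp add: clifford_coeff_linear clifford_coeff_basis if_distrib [of "\<lambda>x. _ * x"] cong: if_cong)

text \<open>
  The norm on the Clifford algebra is the Euclidean norm of the coefficients.  It is not submultiplicative,
  so the analysis of normed algebras does not apply directly; instead, continuity of multiplication
  and similar facts come from finite dimension.
\<close>

lemma bounded_linear_clifford:
  fixes L :: "(real, 'n::{finite,linorder}) clifford \<Rightarrow> 'b::real_normed_vector"
  assumes "linear L"
  shows "bounded_linear L"
proof -
  have "L a = (\<Sum>C\<in>UNIV. clifford_coeff C a *\<^sub>R L (clifford_basis C))" for a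
    by (subst clifford_expansion [of a]) (simp add: linear_sum [OF assms] linear_scale [OF assms])
  then have "L = (\<lambda>a. \<Sum>C\<in>UNIV. clifford_coeff C a *\<^sub>R L (clifford_basis C))" by blast
  moreover have "bounded_linear (\<lambda>a. \<Sum>C\<in>UNIV. clifford_coeff C a *\<^sub>R L (clifford_basis C))"
    by (intro bounded_linear_sum bounded_linear_scaleR_const bounded_linear_clifford_coeff)
  ultimately show ?thesis by simp
qed

lemma bounded_linear_clifford_mult_left:
  "bounded_linear (\<lambda>b. a * b :: (real, 'n::{finite,linorder}) clifford)"
  by (rule bounded_linear_clifford) (auto intro!: linearI simp: algebra_simps)

lemma bounded_bilinear_clifford_mult:
  "bounded_bilinear ((*) :: (real, 'n::{finite,linorder}) clifford \<Rightarrow> _ \<Rightarrow> _)"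
proof
  fix a b c :: "(real, 'n) clifford" and r :: real
  show "(a + b) * c = a * c + b * c" "a * (b + c) = a * b + a * c"
    "(r *\<^sub>R a) * b = r *\<^sub>R (a * b)" "a * (r *\<^sub>R b) = r *\<^sub>R (a * b)"
    by (simp_all add: algebra_simps)
next
  let ?e = "clifford_basis :: 'n set \<Rightarrow> (real, 'n) clifford"
  have "\<forall>C. \<exists>K. \<forall>b. norm (?e C * b) \<le> norm b * K"
    using bounded_linear.bounded [OF bounded_linear_clifford_mult_left] by blast
  then obtain K where K: "\<And>C b. norm (?e C * b) \<le> norm b * K C" by metis
  have coeff_le: "\<bar>clifford_coeff C a\<bar> \<le> norm a" for C and a :: "(real, 'n) clifford"
    by transfer (rule component_le_norm_cart)
  have "norm (a * b) \<le> norm a * norm b * (\<Sum>C\<in>UNIV. K C)" for a b :: "(real, 'n) clifford"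
  proof -
    have "norm (a * b) = norm (\<Sum>C\<in>UNIV. clifford_coeff C a *\<^sub>R (?e C * b))"
      by (subst clifford_expansion [of a]) (simp add: sum_distrib_right)
    also have "\<dots> \<le> (\<Sum>C\<in>UNIV. norm a * (norm b * K C))"
      by (rule sum_norm_le) (simp, intro mult_mono coeff_le K, auto)
    also have "\<dots> = norm a * norm b * (\<Sum>C\<in>UNIV. K C)"
      by (simp add: sum_distrib_left mult.assoc)
    finally show ?thesis .
  qed
  then show "\<exists>K. \<forall>a b :: (real, 'n) clifford. norm (a * b) \<le> norm a * norm b * K" by blast
qed

lemma sums_cliffordI:
  fixes f :: "nat \<Rightarrow> (real, 'n::{finite,linorder}) clifford"
  assumes "\<And>C. (\<lambda>i. clifford_coeff C (f i)) sums clifford_coeff C s"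
  shows "f sums s"
proof -
  have "(\<lambda>i. \<Sum>C\<in>UNIV. clifford_coeff C (f i) *\<^sub>R clifford_basis C) sums
      (\<Sum>C\<in>UNIV. clifford_coeff C s *\<^sub>R (clifford_basis C :: (real, 'n) clifford))"
    by (intro sums_sum bounded_linear.sums [OF bounded_linear_scaleR_left] assms)
  then show ?thesis by (simp only: clifford_expansion [symmetric])
qed

lemma has_vector_derivative_cliffordI:
  fixes f :: "real \<Rightarrow> (real, 'n::{finite,linorder}) clifford"
  assumes "\<And>C. ((\<lambda>t. clifford_coeff C (f t)) has_real_derivative clifford_coeff C d) (at t)"
  shows "(f has_vector_derivative d) (at t)"
proof -
  have "((\<lambda>t. \<Sum>C\<in>UNIV. clifford_coeff C (f t) *\<^sub>R clifford_basis C) has_vector_derivative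
      (\<Sum>C\<in>UNIV. clifford_coeff C d *\<^sub>R (clifford_basis C :: (real, 'n) clifford))) (at t)"
    by (intro has_vector_derivative_sum bounded_linear.has_vector_derivative [OF bounded_linear_scaleR_left]
        assms [THEN iffD1 [OF has_real_derivative_iff_has_vector_derivative]])
  then show ?thesis by (simp only: clifford_expansion [symmetric])
qed

section \<open>Power series and double series\<close>

lemma powser_clifford_has_vector_derivative:
  fixes c :: "nat \<Rightarrow> (real, 'n::{finite,linorder}) clifford"
  assumes "\<And>t. (\<lambda>n. t ^ n *\<^sub>R c n) sums h t"
  obtains h' where "(h has_vector_derivative h') (at t)"
    "(\<lambda>n. t ^ n *\<^sub>R (real (Suc n) *\<^sub>R c (Suc n))) sums h'"
proof -
  have sums_C: "(\<lambda>n. clifford_coeff C (c n) * t ^ n) sums clifford_coeff C (h t)" for C t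
    using bounded_linear.sums [OF bounded_linear_clifford_coeff assms, of C t]
    by (simp add: clifford_coeff_linear mult.commute)
  define y where "y C = (\<Sum>n. diffs (\<lambda>n. clifford_coeff C (c n)) n * t ^ n)" for C
  define h' where "h' = (\<Sum>C\<in>UNIV. y C *\<^sub>R clifford_basis C :: (real, 'n) clifford)"
  have coeff_h': "clifford_coeff C h' = y C" for C
    unfolding h'_def
    by (simp add: clifford_coeff_linear clifford_coeff_basis if_distrib [of "\<lambda>x. _ * x"] cong: if_cong)
  have deriv: "((\<lambda>t. clifford_coeff C (h t)) has_real_derivative y C) (at t)" for C
    using termdiffs_strong_converges_everywhere [of "\<lambda>n. clifford_coeff C (c n)" t] sums_C
    by (simp add: y_def sums_iff)
  have sum': "(\<lambda>n. diffs (\<lambda>n. clifford_coeff C (c n)) n * t ^ n) sums y C" for C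
    unfolding y_def
    by (intro summable_sums termdiff_converges_all) (use sums_C sums_summable in blast)
  show ?thesis
  proof (rule that [of h'])
    show "(h has_vector_derivative h') (at t)"
      by (rule has_vector_derivative_cliffordI) (simp add: coeff_h' deriv)
    show "(\<lambda>n. t ^ n *\<^sub>R (real (Suc n) *\<^sub>R c (Suc n))) sums h'"
      using sum' by (intro sums_cliffordI)
        (simp add: coeff_h' diffs_def mult_ac
           clifford_coeff_linear)
  qed
qed

text \<open>
  Only positive arguments are assumed: the expansions along a ray \<open>s + t e\<close> are compared
  at \<open>t > 0\<close> only, where the equation obtained from monogenicity is free of a division by zero.
\<close>

lemma powser_zero_imp_coeff_zero:
  fixes a :: "nat \<Rightarrow> real"
  assumes "r > 0" and sm: "\<And>t. 0 < t \<Longrightarrow> t < r \<Longrightarrow> (\<lambda>n. a n * t ^ n) sums 0"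
  shows "a n = 0"
proof (induction n rule: less_induct)
  case (less n)
  have "(\<lambda>k. a (k + n) * t ^ k) sums 0" if "0 < t" "t < r" for t
  proof -
    have "(\<lambda>k. a (k + n) * t ^ (k + n)) sums 0"
      using sm [OF that] less by (subst sums_zero_iff_shift) auto
    then have "(\<lambda>k. (a (k + n) * t ^ (k + n)) / t ^ n) sums (0 / t ^ n)"
      by (rule sums_divide)
    then show ?thesis using that by (simp add: power_add)
  qed note pos = this
  let ?b = "\<lambda>k. a (k + n)"
  have sum_b: "(\<lambda>k. ?b k * t ^ k) sums (\<Sum>k. ?b k * t ^ k)" if "norm t < r / 2" for t
    by (rule summable_sums, rule powser_inside [of _ "r / 2"])
       (use pos [of "r / 2"] sums_summable \<open>r > 0\<close> that in auto)
  have "((\<lambda>t. \<Sum>k. ?b k * t ^ k) \<longlongrightarrow> ?b 0) (at 0)"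
    by (rule powser_limit_0 [of "r / 2"]) (use sum_b \<open>r > 0\<close> in auto)
  then have "((\<lambda>t. \<Sum>k. ?b k * t ^ k) \<longlongrightarrow> ?b 0) (at_right 0)"
    by (rule tendsto_mono [OF at_le, rotated]) simp
  moreover have "\<forall>\<^sub>F t in at_right 0. (\<Sum>k. ?b k * t ^ k) = 0"
    using eventually_at_right_real [OF \<open>r > 0\<close>]
    by eventually_elim (rule sums_unique [symmetric], rule pos, auto)
  ultimately have "((\<lambda>t::real. 0::real) \<longlongrightarrow> ?b 0) (at_right 0)"
    by (rule Lim_transform_eventually)
  then have "?b 0 = 0"
    by (rule tendsto_unique [OF trivial_limit_at_right_real _ tendsto_const])
  then show ?case by simp
qed

lemma powser_clifford_unique:
  fixes c d :: "nat \<Rightarrow> (real, 'n::{finite,linorder}) clifford"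
  assumes "r > 0" "\<And>t. 0 < t \<Longrightarrow> t < r \<Longrightarrow> (\<lambda>n. t ^ n *\<^sub>R c n) sums s t"
    "\<And>t. 0 < t \<Longrightarrow> t < r \<Longrightarrow> (\<lambda>n. t ^ n *\<^sub>R d n) sums s t"
  shows "c n = d n"
proof (rule clifford_eqI)
  fix C
  have "(\<lambda>n. clifford_coeff C (c n - d n) * t ^ n) sums 0" if "0 < t" "t < r" for t
  proof -
    have "(\<lambda>n. clifford_coeff C (t ^ n *\<^sub>R (c n - d n))) sums clifford_coeff C 0"
      using sums_diff [OF assms(2,3), OF that that]
      by (intro bounded_linear.sums [OF bounded_linear_clifford_coeff]) (simp add: algebra_simps)
    then show ?thesis
      by (simp add: clifford_coeff_linear mult.commute)
  qed
  from powser_zero_imp_coeff_zero [OF \<open>r > 0\<close> this, of n]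
  show "clifford_coeff C (c n) = clifford_coeff C (d n)"
    by (simp add: clifford_coeff_linear)
qed

text \<open>
  Termwise differentiation with respect to a parameter.  If \<open>F x t\<close> has an expansion \<open>\<Sum> t^b g\<^sub>b(x)\<close>,
  nothing can be said about \<open>\<partial>\<^sub>x F\<close> in general, but a joint expansion in \<open>x\<close> and \<open>t\<close> can be summed in either
  order: summing over the powers of \<open>x\<close> first identifies \<open>g\<^sub>b\<close> with the power series \<open>\<Sum>\<^sub>a u\<^sub>a\<^sub>b x^a\<close>,
  and summing over the powers of \<open>t\<close> first shows that \<open>\<partial>\<^sub>x F 0 t = \<Sum>\<^sub>b u\<^sub>1\<^sub>b t^b\<close>.
\<close>

lemma double_series_partial_derivative:
  fixes u :: "nat \<Rightarrow> nat \<Rightarrow> real"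
  assumes "r > 0"
    and F: "\<And>x t. \<bar>x\<bar> < r \<Longrightarrow> \<bar>t\<bar> < r \<Longrightarrow> ((\<lambda>(a, b). x ^ a * t ^ b * u a b) has_sum F x t) UNIV"
    and g: "\<And>x t. \<bar>x\<bar> < r \<Longrightarrow> \<bar>t\<bar> < r \<Longrightarrow> (\<lambda>b. t ^ b * g b x) sums F x t"
  obtains d where "\<And>b. (g b has_real_derivative d b) (at 0)"
    "\<And>t. \<bar>t\<bar> < r \<Longrightarrow> \<exists>D. ((\<lambda>x. F x t) has_real_derivative D) (at 0) \<and> (\<lambda>b. t ^ b * d b) sums D"
proof -
  have summ: "(\<lambda>(a, b). x ^ a * t ^ b * u a b) summable_on UNIV \<times> UNIV" 
    if "\<bar>x\<bar> < r" "\<bar>t\<bar> < r" for x t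
    using F [OF that] by (auto simp: summable_on_def)
  have summ': "(\<lambda>(b, a). x ^ a * t ^ b * u a b) summable_on UNIV \<times> UNIV" 
    if "\<bar>x\<bar> < r" "\<bar>t\<bar> < r" for x t
    using summable_on_swap [THEN iffD1, OF summ [OF that]] by (simp add: case_prod_unfold)
  have F': "((\<lambda>(b, a). x ^ a * t ^ b * u a b) has_sum F x t) (UNIV \<times> UNIV)" 
    if "\<bar>x\<bar> < r" "\<bar>t\<bar> < r" for x t
    using has_sum_swap [where f = "\<lambda>(a, b). x ^ a * t ^ b * u a b" and A = UNIV and B = UNIV, THEN iffD1] F [OF that]
    by (simp add: case_prod_unfold)
  \<comment> \<open>Columns and rows converge: evaluate the other variable at \<open>r / 2\<close> and divide by its power.\<close>
  have cola: "(\<lambda>a. x ^ a * u a b) summable_on UNIV" if "\<bar>x\<bar> < r" for x b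
  proof -
    have "(\<lambda>a. x ^ a * (r / 2) ^ b * u a b) summable_on UNIV"
      using summable_on_SigmaD1 [OF summ' [of x "r / 2"], of b] that \<open>r > 0\<close> by simp
    then have "(\<lambda>a. (1 / (r / 2) ^ b) * (x ^ a * (r / 2) ^ b * u a b)) summable_on UNIV"
      by (rule summable_on_cmult_right)
    then show ?thesis using \<open>r > 0\<close> by (simp add: field_simps)
  qed
  have rowb: "(\<lambda>b. t ^ b * u a b) summable_on UNIV" if "\<bar>t\<bar> < r" for t a
  proof -
    have "(\<lambda>b. (r / 2) ^ a * t ^ b * u a b) summable_on UNIV"
      using summable_on_SigmaD1 [OF summ [of "r / 2" t], of a] that \<open>r > 0\<close> by simp
    then have "(\<lambda>b. (1 / (r / 2) ^ a) * ((r / 2) ^ a * t ^ b * u a b)) summable_on UNIV"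
      by (rule summable_on_cmult_right)
    then show ?thesis using \<open>r > 0\<close> by (simp add: field_simps)
  qed
  have deriv0: "((\<lambda>x. \<Sum>a. c a * x ^ a) has_real_derivative c 1) (at 0)" 
    if "\<And>x. \<bar>x\<bar> < r \<Longrightarrow> summable (\<lambda>a. c a * x ^ a)" for c :: "nat \<Rightarrow> real"
    using termdiffs_strong' [of r c 0] that \<open>r > 0\<close> by (simp add: diffs_def)
  have near0: "\<forall>\<^sub>F x in nhds (0::real). \<bar>x\<bar> < r"
    using \<open>r > 0\<close> by (intro eventually_nhds_metric [THEN iffD2] exI [of _ r]) (auto simp: dist_norm)
  have g_eq: "g b x = (\<Sum>a. u a b * x ^ a)" if x: "\<bar>x\<bar> < r" for b x
  proof -
    let ?Y = "\<lambda>b. \<Sum>a. u a b * x ^ a"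
    have "((\<lambda>a. x ^ a * u a b) has_sum ?Y b) UNIV" for b
    proof -
      obtain s where s: "((\<lambda>a. x ^ a * u a b) has_sum s) UNIV"
        using cola [OF x] by (auto simp: summable_on_def)
      with has_sum_imp_sums [OF s] show ?thesis by (simp add: sums_iff mult.commute)
    qed
    then have inner: "((\<lambda>a. x ^ a * t ^ b * u a b) has_sum t ^ b * ?Y b) UNIV" for b t
      using has_sum_cmult_right [of "\<lambda>a. x ^ a * u a b" UNIV "?Y b" "t ^ b"] by (simp add: mult_ac)
    have "(\<lambda>b. t ^ b * ?Y b) sums F x t" if "\<bar>t\<bar> < r" for t
      by (rule has_sum_imp_sums, rule has_sum_SigmaD [OF F' [OF x that]])
         (use inner in auto)
    then have "(\<lambda>b. (g b x - ?Y b) * t ^ b) sums 0" if "0 < t" "t < r" for t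
      using sums_diff [OF g [OF x, of t], of "\<lambda>b. t ^ b * ?Y b" "F x t"] that
      by (simp add: algebra_simps)
    from powser_zero_imp_coeff_zero [OF \<open>r > 0\<close> this, of b] show ?thesis by simp
  qed
  show ?thesis
  proof (rule that [of "\<lambda>b. u 1 b"])
    fix b
    have "((\<lambda>x. \<Sum>a. u a b * x ^ a) has_real_derivative u 1 b) (at 0)"
      by (rule deriv0) (use summable_on_imp_summable [OF cola] in \<open>simp add: mult.commute\<close>)
    moreover have "\<forall>\<^sub>F x in nhds 0. g b x = (\<Sum>a. u a b * x ^ a)"
      using near0 by eventually_elim (rule g_eq)
    ultimately show "(g b has_real_derivative u 1 b) (at 0)"
      by (subst DERIV_cong_ev [OF refl _ refl])
  next
    fix t :: real assume t: "\<bar>t\<bar> < r"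
    let ?Z = "\<lambda>a. \<Sum>b. t ^ b * u a b"
    have Z: "((\<lambda>b. t ^ b * u a b) has_sum ?Z a) UNIV" for a
    proof -
      obtain s where s: "((\<lambda>b. t ^ b * u a b) has_sum s) UNIV"
        using rowb [OF t] by (auto simp: summable_on_def)
      with has_sum_imp_sums [OF s] show ?thesis by (simp add: sums_iff)
    qed
    then have inner: "((\<lambda>b. x ^ a * t ^ b * u a b) has_sum x ^ a * ?Z a) UNIV" for a x
      using has_sum_cmult_right [of "\<lambda>b. t ^ b * u a b" UNIV "?Z a" "x ^ a"] by (simp add: mult_ac)
    have F_eq: "(\<lambda>a. ?Z a * x ^ a) sums F x t" if "\<bar>x\<bar> < r" for x
      unfolding mult.commute [of "?Z _"]
      by (rule has_sum_imp_sums, rule has_sum_SigmaD [where A = UNIV and B = "\<lambda>_. UNIV"])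
         (use F [OF that t] inner in auto)
    have "((\<lambda>x. \<Sum>a. ?Z a * x ^ a) has_real_derivative ?Z 1) (at 0)"
      by (rule deriv0) (use F_eq in \<open>auto simp: sums_iff\<close>)
    moreover have "\<forall>\<^sub>F x in nhds 0. F x t = (\<Sum>a. ?Z a * x ^ a)"
      using near0 by eventually_elim (use F_eq in \<open>auto simp: sums_iff\<close>)
    ultimately have "((\<lambda>x. F x t) has_real_derivative ?Z 1) (at 0)"
      by (subst DERIV_cong_ev [OF refl _ refl])
    with has_sum_imp_sums [OF Z, of 1]
    show "\<exists>D. ((\<lambda>x. F x t) has_real_derivative D) (at 0) \<and> (\<lambda>b. t ^ b * u 1 b) sums D" by blast
  qed
qed

lemma double_series_partial_derivative_clifford:
  fixes u :: "nat \<Rightarrow> nat \<Rightarrow> (real, 'n::{finite,linorder}) clifford"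
  assumes "r > 0"
    and F: "\<And>x t. \<bar>x\<bar> < r \<Longrightarrow> \<bar>t\<bar> < r \<Longrightarrow> ((\<lambda>(a, b). (x ^ a * t ^ b) *\<^sub>R u a b) has_sum F x t) UNIV"
    and g: "\<And>x t. \<bar>x\<bar> < r \<Longrightarrow> \<bar>t\<bar> < r \<Longrightarrow> (\<lambda>b. t ^ b *\<^sub>R g b x) sums F x t"
  obtains d where "\<And>b. (g b has_vector_derivative d b) (at 0)"
    "\<And>t. \<bar>t\<bar> < r \<Longrightarrow> \<exists>D. ((\<lambda>x. F x t) has_vector_derivative D) (at 0) \<and> (\<lambda>b. t ^ b *\<^sub>R d b) sums D"
proof -
  let ?P = "\<lambda>C t D. ((\<lambda>x. clifford_coeff C (F x t)) has_real_derivative D) (at 0)"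
  let ?Q = "\<lambda>C d. (\<forall>b. ((\<lambda>x. clifford_coeff C (g b x)) has_real_derivative d b) (at 0)) \<and>
      (\<forall>t. \<bar>t\<bar> < r \<longrightarrow> (\<exists>D. ?P C t D \<and> (\<lambda>b. t ^ b * d b) sums D))"
  have "\<exists>d. ?Q C d" for C
  proof -
    have 1: "((\<lambda>(a, b). x ^ a * t ^ b * clifford_coeff C (u a b)) has_sum clifford_coeff C (F x t)) UNIV"
      if "\<bar>x\<bar> < r" "\<bar>t\<bar> < r" for x t
      using has_sum_bounded_linear [OF bounded_linear_clifford_coeff F [OF that], of C]
      by (simp add: case_prod_unfold clifford_coeff_linear)
    have 2: "(\<lambda>b. t ^ b * clifford_coeff C (g b x)) sums clifford_coeff C (F x t)"
      if "\<bar>x\<bar> < r" "\<bar>t\<bar> < r" for x t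
      using bounded_linear.sums [OF bounded_linear_clifford_coeff g [OF that], of C]
      by (simp add: clifford_coeff_linear)
    show ?thesis
      by (rule double_series_partial_derivative [OF \<open>r > 0\<close> 1 2]) blast+
  qed
  then have "\<exists>d. \<forall>C. ?Q C (d C)" by (intro choice allI)
  then obtain d where dQ: "\<And>C. ?Q C (d C)" by (elim exE) (rule that, erule spec)
  have d: "((\<lambda>x. clifford_coeff C (g b x)) has_real_derivative d C b) (at 0)" for C b
    using dQ [of C] by (elim conjE) (erule spec)
  define D where "D C t = (\<Sum>b. t ^ b * d C b)" for C t
  have D: "?P C t (D C t)" "(\<lambda>b. t ^ b * d C b) sums D C t" if t: "\<bar>t\<bar> < r" for C t
  proof -
    obtain y where "?P C t y" "(\<lambda>b. t ^ b * d C b) sums y"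
      using dQ [of C] t by (elim conjE) (drule spec [of _ t], auto)
    then show "?P C t (D C t)" "(\<lambda>b. t ^ b * d C b) sums D C t"
      by (simp_all add: D_def sums_iff)
  qed
  define V :: "('n set \<Rightarrow> real) \<Rightarrow> (real, 'n) clifford" where
    "V y = (\<Sum>C\<in>UNIV. y C *\<^sub>R clifford_basis C)" for y
  have V: "clifford_coeff C (V y) = y C" for C y
    unfolding V_def
    by (simp add: clifford_coeff_linear clifford_coeff_basis if_distrib [of "\<lambda>x. _ * x"] cong: if_cong)
  show ?thesis
  proof (rule that [of "\<lambda>b. V (\<lambda>C. d C b)"])
    show "(g b has_vector_derivative V (\<lambda>C. d C b)) (at 0)" for b
      by (rule has_vector_derivative_cliffordI) (simp add: V d)
    fix t :: real assume t: "\<bar>t\<bar> < r"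
    show "\<exists>D. ((\<lambda>x. F x t) has_vector_derivative D) (at 0) \<and> (\<lambda>b. t ^ b *\<^sub>R V (\<lambda>C. d C b)) sums D"
    proof (intro exI conjI)
      show "((\<lambda>x. F x t) has_vector_derivative V (\<lambda>C. D C t)) (at 0)"
        by (rule has_vector_derivative_cliffordI) (simp add: V D t)
      show "(\<lambda>b. t ^ b *\<^sub>R V (\<lambda>C. d C b)) sums V (\<lambda>C. D C t)"
        by (rule sums_cliffordI) (simp add: V D t clifford_coeff_linear)
    qed
  qed
qed

section \<open>Real-analytic functions\<close>

lemma real_analytic_const: "real_analytic (\<lambda>x. c)"
  unfolding real_analytic_def
proof (intro allI exI conjI ballI)
  fix p x :: 'a
  let ?z = "\<lambda>b\<in>Basis. 0 :: nat"
  show "((\<lambda>\<alpha>. (\<Prod>b\<in>Basis. ((x - p) \<bullet> b) ^ \<alpha> b) *\<^sub>R (if \<alpha> = ?z then c else 0)) has_sum c)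
      (Basis \<rightarrow>\<^sub>E UNIV)"
    by (rule has_sum_finite_neutralI [of "{?z}"]) auto
qed (rule zero_less_one)

lemma real_analytic_add:
  assumes "real_analytic F" "real_analytic G"
  shows "real_analytic (\<lambda>x. F x + G x)"
  unfolding real_analytic_def
proof
  fix p :: 'a
  obtain r c where "r > 0" and c: "\<And>x. x \<in> ball p r \<Longrightarrow>
      ((\<lambda>\<alpha>. (\<Prod>b\<in>Basis. ((x - p) \<bullet> b) ^ \<alpha> b) *\<^sub>R c \<alpha>) has_sum F x) (Basis \<rightarrow>\<^sub>E UNIV)"
    using assms(1) unfolding real_analytic_def by blast
  obtain s d where "s > 0" and d: "\<And>x. x \<in> ball p s \<Longrightarrow>
      ((\<lambda>\<alpha>. (\<Prod>b\<in>Basis. ((x - p) \<bullet> b) ^ \<alpha> b) *\<^sub>R d \<alpha>) has_sum G x) (Basis \<rightarrow>\<^sub>E UNIV)"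
    using assms(2) unfolding real_analytic_def by blast
  show "\<exists>r>0. \<exists>c. \<forall>x\<in>ball p r.
      ((\<lambda>\<alpha>. (\<Prod>b\<in>Basis. ((x - p) \<bullet> b) ^ \<alpha> b) *\<^sub>R c \<alpha>) has_sum F x + G x) (Basis \<rightarrow>\<^sub>E UNIV)"
  proof (intro exI conjI ballI)
    show "min r s > 0" using \<open>r > 0\<close> \<open>s > 0\<close> by simp
    fix x assume "x \<in> ball p (min r s)"
    then have "x \<in> ball p r" "x \<in> ball p s" by auto
    from has_sum_add [OF c [OF this(1)] d [OF this(2)]]
    show "((\<lambda>\<alpha>. (\<Prod>b\<in>Basis. ((x - p) \<bullet> b) ^ \<alpha> b) *\<^sub>R (c \<alpha> + d \<alpha>)) has_sum F x + G x) (Basis \<rightarrow>\<^sub>E UNIV)"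
      by (simp only: scaleR_add_right)
  qed
qed

lemma real_analytic_sum:
  "(\<And>i. i \<in> I \<Longrightarrow> real_analytic (F i)) \<Longrightarrow> real_analytic (\<lambda>x. \<Sum>i\<in>I. F i x)"
  by (induction I rule: infinite_finite_induct) (auto intro: real_analytic_const real_analytic_add)

lemma real_analytic_bounded_linear:
  fixes F :: "'a::euclidean_space \<Rightarrow> 'b::real_normed_vector"
  assumes "bounded_linear L" "real_analytic F"
  shows "real_analytic (\<lambda>x. L (F x))"
  unfolding real_analytic_def
proof
  interpret bounded_linear L by fact
  fix p :: 'a
  obtain r c where "r > 0" and c: "\<And>x. x \<in> ball p r \<Longrightarrow>
      ((\<lambda>\<alpha>. (\<Prod>b\<in>Basis. ((x - p) \<bullet> b) ^ \<alpha> b) *\<^sub>R c \<alpha>) has_sum F x) (Basis \<rightarrow>\<^sub>E UNIV)"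
    using assms(2) unfolding real_analytic_def by blast
  show "\<exists>r>0. \<exists>c. \<forall>x\<in>ball p r.
      ((\<lambda>\<alpha>. (\<Prod>b\<in>Basis. ((x - p) \<bullet> b) ^ \<alpha> b) *\<^sub>R c \<alpha>) has_sum L (F x)) (Basis \<rightarrow>\<^sub>E UNIV)"
  proof (intro exI conjI ballI)
    show "r > 0" by fact
    fix x assume "x \<in> ball p r"
    from has_sum_bounded_linear [OF assms(1) c [OF this]]
    show "((\<lambda>\<alpha>. (\<Prod>b\<in>Basis. ((x - p) \<bullet> b) ^ \<alpha> b) *\<^sub>R L (c \<alpha>)) has_sum L (F x)) (Basis \<rightarrow>\<^sub>E UNIV)"
      by (simp only: scaleR)
  qed
qed

text \<open>
  Multiplication by a coordinate function preserves analyticity: write \<open>x \<bullet> b\<close> as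
  \<open>p \<bullet> b + (x - p) \<bullet> b\<close>; the first summand scales the coefficients of the expansion at \<open>p\<close>, the second
  shifts them by one in the exponent of \<open>b\<close>.
\<close>

lemma real_analytic_coord:
  assumes "real_analytic F" "b \<in> Basis"
  shows "real_analytic (\<lambda>x. (x \<bullet> b) *\<^sub>R F x)"
  unfolding real_analytic_def
proof
  fix p :: 'a
  let ?E = "Basis \<rightarrow>\<^sub>E (UNIV :: nat set) :: ('a \<Rightarrow> nat) set"
  let ?M = "\<lambda>x \<alpha>. \<Prod>b\<in>Basis. ((x - p) \<bullet> b) ^ \<alpha> b"
  obtain r c where "r > 0" and c: "\<And>x. x \<in> ball p r \<Longrightarrow> ((\<lambda>\<alpha>. ?M x \<alpha> *\<^sub>R c \<alpha>) has_sum F x) ?E"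
    using assms(1) unfolding real_analytic_def by blast
  define d where "d \<alpha> = (if \<alpha> b = 0 then 0 else c (\<alpha>(b := \<alpha> b - 1)))" for \<alpha>
  have d_Suc: "d (\<alpha>(b := Suc (\<alpha> b))) = c \<alpha>" for \<alpha> by (simp add: d_def)
  have mono_Suc: "?M x (\<alpha>(b := Suc (\<alpha> b))) = ((x - p) \<bullet> b) * ?M x \<alpha>" for x \<alpha>
    using assms(2) by (simp add: prod.remove [OF finite_Basis assms(2)] mult.assoc)
  have "((\<lambda>\<alpha>. ?M x \<alpha> *\<^sub>R d \<alpha>) has_sum ((x - p) \<bullet> b) *\<^sub>R F x) ?E" if "x \<in> ball p r" for x
  proof -
    let ?h = "\<lambda>\<alpha>::'a \<Rightarrow> nat. \<alpha>(b := Suc (\<alpha> b))"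
    have inj: "inj_on ?h ?E"
    proof (rule inj_onI)
      fix \<alpha> \<beta> assume "?h \<alpha> = ?h \<beta>"
      then have "?h \<alpha> k = ?h \<beta> k" for k by simp
      then show "\<alpha> = \<beta>" by (metis fun_upd_apply nat.inject ext)
    qed
    have "((\<lambda>\<alpha>. ((x - p) \<bullet> b) *\<^sub>R (?M x \<alpha> *\<^sub>R c \<alpha>)) has_sum ((x - p) \<bullet> b) *\<^sub>R F x) ?E"
      by (intro has_sum_scaleR c that)
    then have "((\<lambda>\<alpha>. ?M x \<alpha> *\<^sub>R d \<alpha>) has_sum ((x - p) \<bullet> b) *\<^sub>R F x) (?h ` ?E)"
      by (subst has_sum_reindex [OF inj]) (simp only: o_def mono_Suc d_Suc scaleR_scaleR)
    also have "?this \<longleftrightarrow> ?thesis"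
    proof (rule has_sum_cong_neutral)
      fix \<alpha> assume \<alpha>: "\<alpha> \<in> ?E - ?h ` ?E"
      have "\<alpha> b = 0"
      proof (rule ccontr)
        assume "\<alpha> b \<noteq> 0"
        then have "\<alpha> = ?h (\<alpha>(b := \<alpha> b - 1))" by auto
        moreover have "\<alpha>(b := \<alpha> b - 1) \<in> ?E" using \<alpha> assms(2) by (auto simp: PiE_iff extensional_def)
        ultimately show False using \<alpha> by blast
      qed
      then show "?M x \<alpha> *\<^sub>R d \<alpha> = 0" by (simp add: d_def)
    next
      have "?h \<alpha> \<in> ?E" if "\<alpha> \<in> ?E" for \<alpha>
        using that assms(2) by (simp add: PiE_iff extensional_def)
      then have "?h ` ?E \<subseteq> ?E" by (rule image_subsetI)
      then have "?h ` ?E - ?E = {}" by (simp only: Diff_eq_empty_iff)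
      then show "?M x \<alpha> *\<^sub>R d \<alpha> = 0" if "\<alpha> \<in> ?h ` ?E - ?E" for \<alpha>
        using that by (simp only: empty_iff)
    qed (rule refl)
    finally show ?thesis .
  qed
  note d_sum = this
  show "\<exists>r>0. \<exists>c. \<forall>x\<in>ball p r. ((\<lambda>\<alpha>. ?M x \<alpha> *\<^sub>R c \<alpha>) has_sum (x \<bullet> b) *\<^sub>R F x) ?E"
  proof (intro exI conjI ballI)
    show "r > 0" by fact
    fix x assume x: "x \<in> ball p r"
    have "((\<lambda>\<alpha>. (p \<bullet> b) *\<^sub>R (?M x \<alpha> *\<^sub>R c \<alpha>) + ?M x \<alpha> *\<^sub>R d \<alpha>) has_sum
        (p \<bullet> b) *\<^sub>R F x + ((x - p) \<bullet> b) *\<^sub>R F x) ?E"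
      by (intro has_sum_add has_sum_scaleR c d_sum x)
    moreover have "(p \<bullet> b) *\<^sub>R F x + ((x - p) \<bullet> b) *\<^sub>R F x = (x \<bullet> b) *\<^sub>R F x"
      by (simp add: scaleR_add_left [symmetric] inner_diff_left)
    moreover have "(p \<bullet> b) *\<^sub>R (?M x \<alpha> *\<^sub>R c \<alpha>) + ?M x \<alpha> *\<^sub>R d \<alpha> =
        ?M x \<alpha> *\<^sub>R ((p \<bullet> b) *\<^sub>R c \<alpha> + d \<alpha>)" for \<alpha>
      by (simp only: scaleR_add_right scaleR_left_commute)
    ultimately show "((\<lambda>\<alpha>. ?M x \<alpha> *\<^sub>R ((p \<bullet> b) *\<^sub>R c \<alpha> + d \<alpha>)) has_sum (x \<bullet> b) *\<^sub>R F x) ?E"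
      by (simp only:)
  qed
qed

text \<open>
  On the plane spanned by the real axis and one generator all other coordinates vanish, so only the
  multi-indices supported on the two coordinates of the plane contribute.
\<close>

lemma real_analytic_plane_series:
  fixes F :: "'n::finite point \<Rightarrow> 'b::real_normed_vector"
  assumes "real_analytic F"
  obtains r u where "r > 0" "\<And>x t. \<bar>x\<bar> < r \<Longrightarrow> \<bar>t\<bar> < r \<Longrightarrow>
    ((\<lambda>(a, b). (x ^ a * t ^ b) *\<^sub>R u a b) has_sum F (s + x, t *\<^sub>R axis i 1)) UNIV"
proof -
  define p :: "'n point" where "p = (s, 0)"
  let ?B = "Basis :: 'n point set"
  let ?E = "?B \<rightarrow>\<^sub>E (UNIV :: nat set)"
  let ?M = "\<lambda>x \<alpha>. \<Prod>b\<in>?B. ((x - p) \<bullet> b) ^ \<alpha> b"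
  obtain r c where "r > 0" and c: "\<And>x. x \<in> ball p r \<Longrightarrow> ((\<lambda>\<alpha>. ?M x \<alpha> *\<^sub>R c \<alpha>) has_sum F x) ?E"
    using assms(1) unfolding real_analytic_def by blast
  define b0 b1 :: "'n point" where "b0 = (1, 0)" and "b1 = (0, axis i 1)"
  define h where "h = (\<lambda>(a, b). \<lambda>\<beta>\<in>?B. if \<beta> = b0 then a else if \<beta> = b1 then b else 0 :: nat)"
  have b01: "b0 \<noteq> b1" "b0 \<in> ?B" "b1 \<in> ?B"
    by (auto simp: b0_def b1_def Basis_prod_def axis_in_Basis_iff)
  have inner0: "(x, t *\<^sub>R axis i 1) \<bullet> \<beta> = (if \<beta> = b0 then x else if \<beta> = b1 then t else 0)" 
    if "\<beta> \<in> ?B" for x t \<beta>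
  proof -
    have "(x, t *\<^sub>R axis i 1) = x *\<^sub>R b0 + t *\<^sub>R b1" by (simp add: b0_def b1_def)
    then have "(x, t *\<^sub>R axis i 1) \<bullet> \<beta> = x * (b0 \<bullet> \<beta>) + t * (b1 \<bullet> \<beta>)"
      by (simp only: inner_add_left inner_scaleR_left)
    also have "\<dots> = (if \<beta> = b0 then x else if \<beta> = b1 then t else 0)"
      using that b01 by (auto simp: inner_Basis)
    finally show ?thesis .
  qed
  have inj: "inj_on h UNIV"
  proof (rule inj_onI)
    fix y z :: "nat \<times> nat" assume "h y = h z"
    then have "h y b0 = h z b0" "h y b1 = h z b1" by simp_all
    then show "y = z" using b01 by (auto simp: h_def split: prod.splits)
  qed
  have mono: "?M (s + x, t *\<^sub>R axis i 1) (h (a, b)) = x ^ a * t ^ b" for x t a b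
  proof -
    have "?M (s + x, t *\<^sub>R axis i 1) (h (a, b)) =
        (\<Prod>\<beta>\<in>?B. (if \<beta> = b0 then x ^ a else 1) * (if \<beta> = b1 then t ^ b else 1))"
      by (intro prod.cong) (auto simp: p_def h_def inner0 b01)
    then show ?thesis using b01 by (simp add: prod.distrib)
  qed
  show ?thesis
  proof (rule that [of "r / 2" "\<lambda>a b. c (h (a, b))"])
    show "r / 2 > 0" using \<open>r > 0\<close> by simp
    fix x t :: real assume xt: "\<bar>x\<bar> < r / 2" "\<bar>t\<bar> < r / 2"
    let ?x = "(s + x, t *\<^sub>R axis i 1) :: 'n point"
    have "dist p ?x \<le> \<bar>x\<bar> + \<bar>t\<bar>"
      using norm_Pair_le [of x "t *\<^sub>R axis i 1 :: (real, 'n) vec"]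
      by (simp add: p_def dist_norm norm_axis_1 norm_minus_commute [of p] norm_prod_def)
    then have "((\<lambda>\<alpha>. ?M ?x \<alpha> *\<^sub>R c \<alpha>) has_sum F ?x) ?E"
      using xt by (intro c) auto
    also have "?this \<longleftrightarrow> ((\<lambda>\<alpha>. ?M ?x \<alpha> *\<^sub>R c \<alpha>) has_sum F ?x) (range h)"
    proof (rule has_sum_cong_neutral)
      fix \<alpha> assume \<alpha>: "\<alpha> \<in> ?E - range h"
      have "\<exists>\<beta>\<in>?B. \<beta> \<noteq> b0 \<and> \<beta> \<noteq> b1 \<and> \<alpha> \<beta> \<noteq> 0"
      proof (rule ccontr)
        assume "\<not> ?thesis"
        then have "\<alpha> = h (\<alpha> b0, \<alpha> b1)" using \<alpha> by (auto simp: h_def PiE_iff extensional_def fun_eq_iff)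
        then show False using \<alpha> by blast
      qed
      then have "?M ?x \<alpha> = 0" by (force simp: p_def inner0 zero_power)
      then show "?M ?x \<alpha> *\<^sub>R c \<alpha> = 0" by simp
    next
      fix \<alpha> assume "\<alpha> \<in> range h - ?E"
      then show "?M ?x \<alpha> *\<^sub>R c \<alpha> = 0" by (auto simp: h_def)
    qed simp
    also have "\<dots> \<longleftrightarrow> ((\<lambda>(a, b). (x ^ a * t ^ b) *\<^sub>R c (h (a, b))) has_sum F ?x) UNIV"
      unfolding has_sum_reindex [OF inj] by (intro has_sum_cong) (simp only: o_def mono split_paired_all prod.case)
    finally show "((\<lambda>(a, b). (x ^ a * t ^ b) *\<^sub>R c (h (a, b))) has_sum F ?x) UNIV" .
  qed
qed

section \<open>Generators and paravectors\<close>

lemma clifford_gen_square: "clifford_gen i * clifford_gen i = (-1 :: (real, 'n::{finite,linorder}) clifford)"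
proof -
  have "2 *\<^sub>R (clifford_gen i * clifford_gen i) = (2 *\<^sub>R (-1) :: (real, 'n) clifford)"
    using clifford_gen_anticommute [of i i, where ?'k = real] by (simp add: scaleR_2)
  then show ?thesis by (simp only: scaleR_cancel_left) simp
qed

lemma clifford_gen_power_left_cancel:
  fixes a b :: "(real, 'n::{finite,linorder}) clifford"
  assumes "clifford_gen i ^ j * a = clifford_gen i ^ j * b"
  shows "a = b"
  using assms
proof (induction j)
  case (Suc j)
  then have "clifford_gen i * (clifford_gen i * (clifford_gen i ^ j * a)) =
      clifford_gen i * (clifford_gen i * (clifford_gen i ^ j * b))"
    by (simp add: mult.assoc)
  then show ?case
    by (intro Suc.IH) (simp add: mult.assoc [symmetric, of "clifford_gen i" "clifford_gen i"] clifford_gen_square)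
qed simp

lemma power_scaleR_clifford:
  "(t *\<^sub>R a) ^ n = (t ^ n *\<^sub>R a ^ n :: (real, 'n::{finite,linorder}) clifford)"
  by (induction n) (simp_all add: mult.commute)

lemma linear_paravector: "linear (paravector :: 'n point \<Rightarrow> (real, 'n::{finite,linorder}) clifford)"
  by (rule linearI)
     (simp_all add: paravector_def of_real_def sum.distrib scaleR_add_left scaleR_add_right scaleR_sum_right)

lemma bounded_linear_paravector:
  "bounded_linear (paravector :: 'n point \<Rightarrow> (real, 'n::{finite,linorder}) clifford)"
  using linear_paravector linear_conv_bounded_linear by blast

lemma paravector_axis: "paravector (s, t *\<^sub>R axis i 1) = (of_real s + t *\<^sub>R clifford_gen i :: (real, 'n::{finite,linorder}) clifford)"
proof -
  have "(\<Sum>j\<in>UNIV. (t *\<^sub>R axis i 1 :: (real, 'n) vec) $ j *\<^sub>R clifford_gen j) = (\<Sum>j\<in>UNIV. if j = i then t *\<^sub>R clifford_gen j else (0 :: (real, 'n) clifford))"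
    by (intro sum.cong) (auto simp: axis_def)
  then show ?thesis by (simp add: paravector_def)
qed

lemma paravector_split:
  "paravector x = (of_real (fst x) + paravector (vec_part x) :: (real, 'n::{finite,linorder}) clifford)"
  by (simp add: paravector_def vec_part_def)

lemma paravector_vec_part_square:
  "paravector (vec_part x) * paravector (vec_part x) = - (of_real ((norm (snd x))\<^sup>2) :: (real, 'n::{finite,linorder}) clifford)"
proof -
  have "conj_point (vec_part x) = - vec_part x" by (simp add: conj_point_def vec_part_def)
  then have "paravector (vec_part x) * - paravector (vec_part x) = (of_real ((norm (vec_part x))\<^sup>2) :: (real, 'n) clifford)"
    using paravector_mult_conj [of "vec_part x", where ?'k = real]
    by (simp only: linear_neg [OF linear_paravector])
  moreover have "norm (vec_part x) = norm (snd x)" by (simp add: vec_part_def norm_prod_def)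
  ultimately show ?thesis by (metis minus_mult_right minus_minus)
qed

section \<open>Uniqueness of the generalized CK extension\<close>

text \<open>
  The factor \<open>w\<close> for which the Dirac operator \<open>\<Sum>\<^sub>j e\<^sub>j \<partial>\<^sub>j\<close> in \<open>m\<close> variables maps \<open>v^i\<close> to
  \<open>- w v^(i-1)\<close>.
\<close>

definition dirac_weight :: "nat \<Rightarrow> nat \<Rightarrow> real" where
  "dirac_weight m i = (if even i then real i else real i + (real m - 1))"

text \<open>
  An axial function is recovered from its restriction to the plane of a single generator \<open>e\<close>: half the
  sum and half the difference of the values at \<open>s + r e\<close> and \<open>s - r e\<close> are \<open>A\<close> and \<open>e B\<close>.
\<close>

lemma axial_form_off_axis:
  fixes F :: "'n::{finite,linorder} point \<Rightarrow> (real, 'n) clifford"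
  assumes "axial_form F" "v \<noteq> 0"
  shows "F (s, v) =
    (1 / 2) *\<^sub>R (F (s, norm v *\<^sub>R axis i 1) + F (s, - norm v *\<^sub>R axis i 1)) +
    paravector (0, v) * ((1 / norm v) *\<^sub>R ((- 1 / 2) *\<^sub>R
      (clifford_gen i * (F (s, norm v *\<^sub>R axis i 1) - F (s, - norm v *\<^sub>R axis i 1)))))"
proof -
  obtain A B where even: "\<And>s r. A s (- r) = A s r" and
    F: "\<And>x. F x = A (fst x) (norm (snd x)) +
                (1 / norm (snd x)) *\<^sub>R paravector (vec_part x) * B (fst x) (norm (snd x))"
    using assms(1) unfolding axial_form_def by blast
  let ?e = "clifford_gen i :: (real, 'n) clifford" and ?\<rho> = "norm v"
  have \<rho>: "?\<rho> \<noteq> 0" using assms(2) by simp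
  have plus: "F (s, ?\<rho> *\<^sub>R axis i 1) = A s ?\<rho> + ?e * B s ?\<rho>"
    using \<rho> by (simp add: F vec_part_def paravector_axis norm_axis_1)
  have minus: "F (s, - ?\<rho> *\<^sub>R axis i 1) = A s ?\<rho> - ?e * B s ?\<rho>"
    using \<rho> by (simp add: F vec_part_def paravector_axis [of _ "- ?\<rho>", simplified] norm_axis_1)
  have A: "(1 / 2) *\<^sub>R (F (s, ?\<rho> *\<^sub>R axis i 1) + F (s, - ?\<rho> *\<^sub>R axis i 1)) = A s ?\<rho>"
    unfolding plus minus by (simp add: scaleR_2 [symmetric])
  have "?e * (F (s, ?\<rho> *\<^sub>R axis i 1) - F (s, - ?\<rho> *\<^sub>R axis i 1)) = 2 *\<^sub>R (?e * ?e * B s ?\<rho>)"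
    unfolding plus minus by (simp add: scaleR_2 algebra_simps)
  then have B: "(- 1 / 2) *\<^sub>R (?e * (F (s, ?\<rho> *\<^sub>R axis i 1) - F (s, - ?\<rho> *\<^sub>R axis i 1))) = B s ?\<rho>"
    by (simp add: clifford_gen_square)
  show ?thesis unfolding A B by (simp add: F vec_part_def)
qed

text \<open>
  At a point \<open>s + t e\<close> with \<open>t > 0\<close> the radius \<open>sqrt (t\<^sup>2 + \<tau>\<^sup>2)\<close> is stationary under a shift by \<open>\<tau>\<close> in any
  direction orthogonal to \<open>e\<close>.  Such a tangential derivative therefore sees only the factor \<open>v\<close> in
  \<open>A + v B / r\<close>, and each of the \<open>m - 1\<close> of them contributes \<open>e\<^sub>j (e\<^sub>j B / t) = - B / t\<close>.
\<close>

lemma dirac_on_axis_plane: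
  fixes F :: "'n::{finite,linorder} point \<Rightarrow> (real, 'n) clifford"
  assumes "monogenic F" "axial_form F" "t > 0"
    and s: "((\<lambda>x. F (s + x, t *\<^sub>R axis i 1)) has_vector_derivative D) (at 0)"
    and t: "\<And>t. \<exists>h'. ((\<lambda>t. F (s, t *\<^sub>R axis i 1)) has_vector_derivative h') (at t)"
    and h': "((\<lambda>t. F (s, t *\<^sub>R axis i 1)) has_vector_derivative h') (at t)"
  shows "D + clifford_gen i * h' + (real CARD('n) - 1) *\<^sub>R (clifford_gen i *
      ((1 / (2 * t)) *\<^sub>R (F (s, t *\<^sub>R axis i 1) - F (s, - t *\<^sub>R axis i 1)))) = 0"
proof -
  let ?e = "clifford_gen :: 'n \<Rightarrow> (real, 'n) clifford"
  define h where "h t = F (s, t *\<^sub>R axis i 1)" for t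
  define x where "x = (s, t *\<^sub>R axis i 1 :: (real, 'n) vec)"
  define \<alpha> where "\<alpha> \<rho> = (1 / 2) *\<^sub>R (h \<rho> + h (- \<rho>))" for \<rho>
  define \<gamma> where "\<gamma> \<rho> = (1 / \<rho>) *\<^sub>R ((- 1 / 2) *\<^sub>R (?e i * (h \<rho> - h (- \<rho>))))" for \<rho>
  have h_diff: "h differentiable at \<tau>" for \<tau>
    using t [of \<tau>] unfolding h_def by (auto intro: differentiableI_vector)
  have hm_diff: "(\<lambda>\<rho>. h (- \<rho>)) differentiable at \<tau>" for \<tau>
    using differentiable_chain_at [of uminus \<tau> h] h_diff by (simp add: o_def)
  have p0: "partial_x0 F x = D"
    unfolding partial_deriv_def
    by (rule vector_derivative_at) (use s in \<open>simp add: x_def\<close>)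
  have pi: "partial_deriv (0, axis i 1) F x = h'"
    unfolding partial_deriv_def
  proof (rule vector_derivative_at)
    have "(h \<circ> (\<lambda>\<tau>. t + \<tau>) has_vector_derivative 1 *\<^sub>R h') (at 0)"
      by (rule vector_diff_chain_at)
         (use h' in \<open>auto simp: h_def [abs_def] intro!: derivative_eq_intros\<close>)
    then show "((\<lambda>\<tau>. F (x + \<tau> *\<^sub>R (0, axis i 1))) has_vector_derivative h') (at 0)"
      by (simp add: o_def h_def x_def scaleR_add_left)
  qed
  have pj: "?e j * partial_deriv (0, axis j 1) F x = - \<gamma> t" if "j \<noteq> i" for j
  proof -
    define \<rho> where "\<rho> \<tau> = sqrt (t\<^sup>2 + \<tau>\<^sup>2)" for \<tau>
    have \<rho>0: "\<rho> 0 = t" using \<open>t > 0\<close> by (simp add: \<rho>_def)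
    have d\<rho>: "(\<rho> has_vector_derivative 0) (at 0)"
      unfolding \<rho>_def has_real_derivative_iff_has_vector_derivative [symmetric]
      using \<open>t > 0\<close> by (auto intro!: derivative_eq_intros)
    have d\<alpha>: "(\<alpha> \<circ> \<rho> has_vector_derivative 0) (at 0)"
    proof -
      have "\<alpha> differentiable at t" unfolding \<alpha>_def
        by (intro differentiable_scaleR differentiable_const differentiable_add h_diff hm_diff)
      then obtain a where "(\<alpha> has_vector_derivative a) (at (\<rho> 0))"
        unfolding \<rho>0 using vector_derivative_works by blast
      from vector_diff_chain_at [OF d\<rho> this] show ?thesis by simp
    qed
    have d\<gamma>: "(\<gamma> \<circ> \<rho> has_vector_derivative 0) (at 0)"
    proof -
      have "(\<lambda>\<rho>. ?e i * (h \<rho> - h (- \<rho>))) differentiable at t"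
        using differentiable_diff [OF h_diff hm_diff, of t]
          bounded_linear_imp_differentiable [OF bounded_linear_clifford_mult_left [of "?e i"]]
          differentiable_chain_at [of "\<lambda>\<rho>. h \<rho> - h (- \<rho>)" t "\<lambda>a. ?e i * a"]
        by (simp add: o_def)
      then have "\<gamma> differentiable at t" unfolding \<gamma>_def
        using \<open>t > 0\<close> by (intro differentiable_scaleR differentiable_const differentiable_divide) auto
      then obtain a where "(\<gamma> has_vector_derivative a) (at (\<rho> 0))"
        unfolding \<rho>0 using vector_derivative_works by blast
      from vector_diff_chain_at [OF d\<rho> this] show ?thesis by simp
    qed
    have norm: "norm (t *\<^sub>R axis i 1 + \<tau> *\<^sub>R axis j 1 :: (real, 'n) vec) = \<rho> \<tau>" for \<tau>
    proof -
      have "orthogonal (t *\<^sub>R axis i 1) (\<tau> *\<^sub>R axis j 1 :: (real, 'n) vec)"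
        using that by (simp add: orthogonal_def inner_axis_axis)
      then have "(norm (t *\<^sub>R axis i 1 + \<tau> *\<^sub>R axis j 1 :: (real, 'n) vec))\<^sup>2 = t\<^sup>2 + \<tau>\<^sup>2"
        by (simp add: norm_add_Pythagorean norm_axis_1)
      then show ?thesis unfolding \<rho>_def by (metis norm_ge_zero real_sqrt_unique)
    qed
    have \<rho>_pos: "\<rho> \<tau> > 0" for \<tau>
      using \<open>t > 0\<close> by (simp add: \<rho>_def add_pos_nonneg)
    have eq: "F (x + \<tau> *\<^sub>R (0, axis j 1)) =
        (\<alpha> \<circ> \<rho>) \<tau> + (t *\<^sub>R ?e i + \<tau> *\<^sub>R ?e j) * (\<gamma> \<circ> \<rho>) \<tau>" for \<tau>
    proof -
      let ?v = "t *\<^sub>R axis i 1 + \<tau> *\<^sub>R axis j 1 :: (real, 'n) vec"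
      have v: "?v \<noteq> 0" using \<rho>_pos [of \<tau>] norm [of \<tau>] by (metis less_irrefl norm_zero)
      have "paravector (0, ?v) = paravector ((0, t *\<^sub>R axis i 1) + (0, \<tau> *\<^sub>R axis j 1 :: (real, 'n) vec))" by simp
      also have "\<dots> = t *\<^sub>R ?e i + \<tau> *\<^sub>R ?e j"
        unfolding linear_add [OF linear_paravector] paravector_axis by simp
      finally show ?thesis
        using axial_form_off_axis [OF assms(2) v, of s i]
        by (simp add: x_def norm \<alpha>_def \<gamma>_def h_def)
    qed
    have "((\<lambda>\<tau>. (\<alpha> \<circ> \<rho>) \<tau> + (t *\<^sub>R ?e i + \<tau> *\<^sub>R ?e j) * (\<gamma> \<circ> \<rho>) \<tau>) has_vector_derivative
        0 + ((t *\<^sub>R ?e i + 0 *\<^sub>R ?e j) * 0 + ?e j * (\<gamma> \<circ> \<rho>) 0)) (at 0)"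
      by (intro has_vector_derivative_add d\<alpha> bounded_bilinear.has_vector_derivative
           [OF bounded_bilinear_clifford_mult] d\<gamma>) (auto intro!: derivative_eq_intros)
    then have "partial_deriv (0, axis j 1) F x = ?e j * \<gamma> t"
      unfolding partial_deriv_def eq [symmetric] using \<rho>0 by (intro vector_derivative_at) simp
    then show ?thesis by (simp add: mult.assoc [symmetric] clifford_gen_square)
  qed
  have "0 = partial_x0 F x + (\<Sum>j\<in>UNIV. ?e j * partial_deriv (0, axis j 1) F x)"
    using assms(1) unfolding monogenic_def by (metis (no_types))
  also have "(\<Sum>j\<in>UNIV. ?e j * partial_deriv (0, axis j 1) F x) =
      ?e i * h' + (\<Sum>j\<in>UNIV - {i}. - \<gamma> t)"
    by (subst sum.remove [of _ i]) (auto simp: pi pj intro!: sum.cong)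
  also have "(\<Sum>j\<in>UNIV - {i}. - \<gamma> t) = (real CARD('n) - 1) *\<^sub>R - \<gamma> t"
    by (simp only: sum_constant_scaleR) (simp add: of_nat_diff Suc_le_eq)
  also have "- \<gamma> t = ?e i * ((1 / (2 * t)) *\<^sub>R (h t - h (- t)))"
    by (simp add: \<gamma>_def)
  finally show ?thesis unfolding p0 h_def by (simp add: add.assoc)
qed

text \<open>
  Comparison of the coefficients of \<open>t^n\<close> in the equation on the plane of \<open>e\<close>.  The derivative with respect
  to \<open>s\<close> is taken termwise, which is where the analyticity of the function is essential; the
  difference quotient \<open>(F(s + t e) - F(s - t e)) / (2 t)\<close> keeps exactly the odd powers, whence the
  dependence of the weight on parity.
\<close>

lemma gck_coefficient_recursion:
  fixes F :: "'n::{finite,linorder} point \<Rightarrow> (real, 'n) clifford"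
  assumes "axially_monogenic F" 
    and f: "\<And>x. (\<lambda>j. paravector (vec_part x) ^ j * f j (fst x)) sums F x"
  shows "((\<lambda>x. clifford_gen i ^ j * f j (s + x)) has_vector_derivative
           dirac_weight CARD('n) (Suc j) *\<^sub>R (clifford_gen i ^ j * f (Suc j) s)) (at 0)"
proof -
  let ?e = "clifford_gen i :: (real, 'n) clifford"
  note analytic = assms(1) [unfolded axially_monogenic_def, THEN conjunct1]
    and mono = assms(1) [unfolded axially_monogenic_def, THEN conjunct2, THEN conjunct1]
    and axial = assms(1) [unfolded axially_monogenic_def, THEN conjunct2, THEN conjunct2]
  define c where "c n x = ?e ^ n * f n x" for n x
  have series: "(\<lambda>n. t ^ n *\<^sub>R c n x) sums F (x, t *\<^sub>R axis i 1)" for x t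
    using f [of "(x, t *\<^sub>R axis i 1)"] by (simp add: vec_part_def paravector_axis c_def power_scaleR_clifford)
  obtain r u where "r > 0" and u: "\<And>x t. \<bar>x\<bar> < r \<Longrightarrow> \<bar>t\<bar> < r \<Longrightarrow>
      ((\<lambda>(a, b). (x ^ a * t ^ b) *\<^sub>R u a b) has_sum F (s + x, t *\<^sub>R axis i 1)) UNIV"
    by (rule real_analytic_plane_series [OF analytic]) blast
  obtain d where d: "\<And>b. ((\<lambda>x. c b (s + x)) has_vector_derivative d b) (at 0)"
    and D: "\<And>t. \<bar>t\<bar> < r \<Longrightarrow> \<exists>D. ((\<lambda>x. F (s + x, t *\<^sub>R axis i 1)) has_vector_derivative D) (at 0) \<and>
      (\<lambda>b. t ^ b *\<^sub>R d b) sums D"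
    by (rule double_series_partial_derivative_clifford [OF \<open>r > 0\<close> u, of "\<lambda>b x. c b (s + x)"])
       (use series in auto)
  have "(\<lambda>n. t ^ n *\<^sub>R (d n - dirac_weight CARD('n) (Suc n) *\<^sub>R (?e ^ n * f (Suc n) s))) sums 0"
    if t: "0 < t" "t < r" for t
  proof -
    obtain D where D: "((\<lambda>x. F (s + x, t *\<^sub>R axis i 1)) has_vector_derivative D) (at 0)"
      "(\<lambda>b. t ^ b *\<^sub>R d b) sums D" using D [of t] t by auto
    have ex: "\<exists>h'. ((\<lambda>t. F (s, t *\<^sub>R axis i 1)) has_vector_derivative h') (at t)" for t
      by (rule powser_clifford_has_vector_derivative
          [where c = "\<lambda>n. c n s" and h = "\<lambda>t. F (s, t *\<^sub>R axis i 1)" and t = t, OF series]) blast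
    obtain h' where h': "((\<lambda>t. F (s, t *\<^sub>R axis i 1)) has_vector_derivative h') (at t)"
      "(\<lambda>n. t ^ n *\<^sub>R (real (Suc n) *\<^sub>R c (Suc n) s)) sums h'"
      by (rule powser_clifford_has_vector_derivative
          [where c = "\<lambda>n. c n s" and h = "\<lambda>t. F (s, t *\<^sub>R axis i 1)" and t = t, OF series])
    have "(\<lambda>n. (1 / (2 * t)) *\<^sub>R (t ^ n *\<^sub>R c n s - (- t) ^ n *\<^sub>R c n s)) sums
        ((1 / (2 * t)) *\<^sub>R (F (s, t *\<^sub>R axis i 1) - F (s, - t *\<^sub>R axis i 1)))"
      by (intro sums_scaleR_right sums_diff series)
    then have "(\<lambda>n. (1 / (2 * t)) *\<^sub>R (t ^ Suc n *\<^sub>R c (Suc n) s - (- t) ^ Suc n *\<^sub>R c (Suc n) s)) sums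
        ((1 / (2 * t)) *\<^sub>R (F (s, t *\<^sub>R axis i 1) - F (s, - t *\<^sub>R axis i 1)))"
      by (subst sums_Suc_iff) simp
    also have "(\<lambda>n. (1 / (2 * t)) *\<^sub>R (t ^ Suc n *\<^sub>R c (Suc n) s - (- t) ^ Suc n *\<^sub>R c (Suc n) s)) =
        (\<lambda>n. t ^ n *\<^sub>R ((if even n then 1 else 0) *\<^sub>R c (Suc n) s))"
      using t by (auto simp: fun_eq_iff scaleR_left_diff_distrib [symmetric] scaleR_add_left [symmetric])
    finally have odd: "(\<lambda>n. t ^ n *\<^sub>R ((if even n then 1 else 0) *\<^sub>R c (Suc n) s)) sums
        ((1 / (2 * t)) *\<^sub>R (F (s, t *\<^sub>R axis i 1) - F (s, - t *\<^sub>R axis i 1)))" .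
    note mult = bounded_linear.sums [OF bounded_linear_clifford_mult_left [of ?e]]
    have "(\<lambda>n. t ^ n *\<^sub>R d n + ?e * (t ^ n *\<^sub>R (real (Suc n) *\<^sub>R c (Suc n) s)) +
         (real CARD('n) - 1) *\<^sub>R (?e * (t ^ n *\<^sub>R ((if even n then 1 else 0) *\<^sub>R c (Suc n) s)))) sums 0"
      using sums_add [OF sums_add [OF D(2) mult [OF h'(2)]]
          sums_scaleR_right [OF mult [OF odd], of "real CARD('n) - 1"]]
      unfolding dirac_on_axis_plane [OF mono axial t(1) D(1) ex h'(1)] .
    moreover have "?e * c (Suc n) s = - (?e ^ n * f (Suc n) s)" for n
      by (simp add: c_def mult.assoc [symmetric] clifford_gen_square)
    then have "t ^ n *\<^sub>R d n + ?e * (t ^ n *\<^sub>R (real (Suc n) *\<^sub>R c (Suc n) s)) +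
         (real CARD('n) - 1) *\<^sub>R (?e * (t ^ n *\<^sub>R ((if even n then 1 else 0) *\<^sub>R c (Suc n) s))) =
        t ^ n *\<^sub>R (d n - dirac_weight CARD('n) (Suc n) *\<^sub>R (?e ^ n * f (Suc n) s))" for n
      by (simp add: dirac_weight_def scaleR_add_left scaleR_diff_right algebra_simps)
    ultimately show ?thesis by simp
  qed
  from powser_clifford_unique [OF \<open>r > 0\<close> this, of "\<lambda>_. 0" j]
  have "d j = dirac_weight CARD('n) (Suc j) *\<^sub>R (?e ^ j * f (Suc j) s)" by simp
  with d [of j] show ?thesis by (simp add: c_def)
qed

text \<open>
  The weights in the recursion are positive, so it can be solved for the next coefficient, after
  cancelling the invertible factor \<open>e^j\<close>.
\<close>

lemma gck_extension_unique:
  fixes F G :: "'n::{finite,linorder} point \<Rightarrow> (real, 'n) clifford"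
  assumes "axially_monogenic F" "\<And>x. (\<lambda>j. paravector (vec_part x) ^ j * f j (fst x)) sums F x"
    and "axially_monogenic G" "\<And>x. (\<lambda>j. paravector (vec_part x) ^ j * g j (fst x)) sums G x"
    and axis: "\<And>s. F (s, 0) = G (s, 0)"
  shows "F = G"
proof -
  fix i :: 'n
  have zero: "H (s, 0) = h 0 s" if "\<And>x. (\<lambda>j. paravector (vec_part x) ^ j * h j (fst x)) sums H x"
    for h s and H :: "'n point \<Rightarrow> (real, 'n) clifford"
  proof -
    have "paravector (vec_part (s, 0 :: (real, 'n) vec)) = (0 :: (real, 'n) clifford)"
      by (simp add: vec_part_def paravector_def)
    then have "(\<lambda>j. 0 ^ j * h j s) sums H (s, 0)" using that [of "(s, 0)"] by simp
    moreover have "(\<lambda>j. 0 ^ j * h j s) sums (\<Sum>j\<in>{0}. 0 ^ j * h j s)"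
      by (rule sums_finite) (auto simp: power_0_left)
    ultimately show ?thesis by (simp add: sums_unique2)
  qed
  have "f j s = g j s" for j s
  proof (induction j arbitrary: s)
    case 0
    then show ?case using axis [of s] zero [OF assms(2), of s] zero [OF assms(4), of s] by simp
  next
    case (Suc j)
    let ?w = "dirac_weight CARD('n) (Suc j)"
    have "real CARD('n) > 0" by simp
    then have "?w \<noteq> 0" unfolding dirac_weight_def by (smt (verit) of_nat_0_le_iff of_nat_Suc)
    have "?w *\<^sub>R (clifford_gen i ^ j * f (Suc j) s) = ?w *\<^sub>R (clifford_gen i ^ j * g (Suc j) s)"
      using gck_coefficient_recursion [OF assms(1,2), of i j s]
        gck_coefficient_recursion [OF assms(3,4), of i j s]
      unfolding Suc.IH by (rule vector_derivative_unique_at)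
    with \<open>?w \<noteq> 0\<close> show ?case
      by (metis scaleR_cancel_left clifford_gen_power_left_cancel)
  qed
  then have "f = g" by (intro ext)
  show ?thesis
  proof
    show "F x = G x" for x
      using assms(2) [of x] assms(4) [of x] unfolding \<open>f = g\<close> by (rule sums_unique2)
  qed
qed

section \<open>Vandermonde sums of Pochhammer symbols\<close>

text \<open>
  The coefficient of \<open>x^(n-j) y^j / n!\<close> in the degree \<open>n\<close> part of \<open>(1 - x)^(-a) (1 - y)^(-b)\<close>.
\<close>

definition vandermonde_term :: "real \<Rightarrow> real \<Rightarrow> nat \<Rightarrow> nat \<Rightarrow> real" where
  "vandermonde_term a b n j = real (n choose j) * pochhammer a (n - j) * pochhammer b j"

text \<open>
  The Leibniz rule in coefficient form: it drives both the iterated derivatives of the kernel, with \<open>u\<close> the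
  terms produced by one more differentiation, and the Vandermonde convolution, with \<open>u = 1\<close>.
\<close>

lemma vandermonde_term_step:
  fixes u :: "nat \<Rightarrow> 'a::real_vector"
  shows "(\<Sum>j\<le>n. vandermonde_term a b n j *\<^sub>R ((b + real j) *\<^sub>R u (Suc j) + (a + real (n - j)) *\<^sub>R u j)) =
    (\<Sum>j\<le>Suc n. vandermonde_term a b (Suc n) j *\<^sub>R u j)"
proof -
  let ?c = "vandermonde_term a b"
  have zero: "?c (Suc n) 0 = ?c n 0 * (a + real n)"
    by (simp add: vandermonde_term_def pochhammer_Suc)
  have Suc: "?c (Suc n) (Suc j) = ?c n j * (b + real j) + ?c n (Suc j) * (a + real (n - Suc j))" for j
  proof (cases "j < n")
    case True
    then have "pochhammer a (n - j) = pochhammer a (n - Suc j) * (a + real (n - Suc j))"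
      by (metis Suc_diff_Suc pochhammer_Suc)
    then show ?thesis
      by (simp add: vandermonde_term_def pochhammer_Suc algebra_simps)
  qed (simp add: vandermonde_term_def binomial_eq_0 pochhammer_Suc)
  have "(\<Sum>j\<le>Suc n. ?c (Suc n) j *\<^sub>R u j) =
      (\<Sum>j\<le>n. (?c n j * (b + real j)) *\<^sub>R u (Suc j)) +
      (((?c n 0 * (a + real n)) *\<^sub>R u 0) + (\<Sum>j\<le>n. (?c n (Suc j) * (a + real (n - Suc j))) *\<^sub>R u (Suc j)))"
    by (simp only: sum.atMost_Suc_shift zero Suc scaleR_add_left sum.distrib add_ac)
  also have "((?c n 0 * (a + real n)) *\<^sub>R u 0) + (\<Sum>j\<le>n. (?c n (Suc j) * (a + real (n - Suc j))) *\<^sub>R u (Suc j))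
      = (\<Sum>j\<le>Suc n. (?c n j * (a + real (n - j))) *\<^sub>R u j)"
    by (simp only: sum.atMost_Suc_shift diff_zero)
  also have "\<dots> = (\<Sum>j\<le>n. (?c n j * (a + real (n - j))) *\<^sub>R u j)"
    by (simp add: vandermonde_term_def)
  finally show ?thesis
    by (simp add: sum.distrib scaleR_add_right)
qed

lemma vandermonde_sum: "(\<Sum>j\<le>n. vandermonde_term a b n j) = pochhammer (a + b) n"
proof (induction n)
  case (Suc n)
  have "(\<Sum>j\<le>Suc n. vandermonde_term a b (Suc n) j) =
      (\<Sum>j\<le>n. vandermonde_term a b n j * ((b + real j) + (a + real (n - j))))"
    using vandermonde_term_step [of a b n "\<lambda>_. 1 :: real"] by simp
  also have "\<dots> = (\<Sum>j\<le>n. vandermonde_term a b n j * (a + b + real n))"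
    by (intro sum.cong) (auto simp: of_nat_diff)
  finally show ?case by (simp add: sum_distrib_right [symmetric] Suc.IH pochhammer_Suc mult.commute)
qed (simp add: vandermonde_term_def)

text \<open>
  The coefficientwise content of the functional equation below.  For \<open>a = b + 1\<close> the symbols \<open>(a)\<^sub>n\<close> and
  \<open>(b)\<^sub>n\<^sub>+\<^sub>1\<close> differ only by the factor \<open>b\<close>, so that reversing the order of the terms, which exchanges the roles
  of \<open>a\<close> and \<open>b\<close>, can be compensated.
\<close>

lemma vandermonde_term_exchange:
  assumes "j \<le> k"
  shows "real (Suc j) * vandermonde_term (b + 1) b k (Suc j) - real j * vandermonde_term (b + 1) b k j =
    b * (vandermonde_term (b + 1) b k j - vandermonde_term (b + 1) b k (k - j))"
proof -
  have rec: "pochhammer b (Suc n) = b * pochhammer (b + 1) n" for n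
    by (rule pochhammer_rec)
  show ?thesis
  proof (cases "j = k")
    case True
    have "(b + real k) * pochhammer b k = b * pochhammer (b + 1) k"
      using rec [of k] by (simp add: pochhammer_Suc mult.commute)
    then show ?thesis using True by (simp add: vandermonde_term_def binomial_eq_0 algebra_simps)
  next
    case False
    with assms have "j < k" by simp
    define l where "l = k - Suc j"
    have kj: "k - j = Suc l" using \<open>j < k\<close> by (simp add: l_def)
    define C where "C = real (k choose j)"
    have "(k choose Suc j) * Suc j = (k choose j) * (k - j)"
      by (metis binomial_absorb_comp binomial_absorption mult.commute kj l_def Suc_diff_Suc \<open>j < k\<close> binomial_fact_lemma)
    then have 1: "real (Suc j) * real (k choose Suc j) = C * (real l + 1)"
      unfolding kj C_def by (metis of_nat_mult mult.commute of_nat_Suc add.commute)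
    have 2: "real (k choose (k - j)) = C" using assms by (simp add: C_def binomial_symmetric [symmetric])
    have c_Suc: "real (Suc j) * vandermonde_term (b + 1) b k (Suc j) =
        C * (real l + 1) * (pochhammer (b + 1) l * pochhammer b (Suc j))"
      unfolding 1 [symmetric] by (simp add: vandermonde_term_def l_def mult_ac del: of_nat_Suc)
    have c_j: "vandermonde_term (b + 1) b k j = C * (pochhammer (b + 1) l * (b + 1 + real l)) * pochhammer b j"
      by (simp add: vandermonde_term_def C_def kj pochhammer_Suc)
    have c_kj: "b * vandermonde_term (b + 1) b k (k - j) = C * (pochhammer b (Suc j) * pochhammer b (Suc l))"
      proof -
      have "k - (k - j) = j" using assms by simp
      then show ?thesis unfolding vandermonde_term_def 2 rec [of j] using kj by simp
    qed
    have "real (Suc j) * vandermonde_term (b + 1) b k (Suc j) - real j * vandermonde_term (b + 1) b k j -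
        b * vandermonde_term (b + 1) b k j + b * vandermonde_term (b + 1) b k (k - j) =
        C * (pochhammer (b + 1) l * pochhammer b (Suc j) * (real l + 1) -
          pochhammer (b + 1) l * (b + 1 + real l) * (pochhammer b j * (b + real j)) +
          pochhammer b (Suc j) * pochhammer b (Suc l))"
      unfolding c_Suc c_j c_kj by (simp add: algebra_simps)
    also have "\<dots> = 0" unfolding rec [of l] pochhammer_Suc [of b j] by (simp add: algebra_simps)
    finally show ?thesis by (simp add: algebra_simps)
  qed
qed

section \<open>The coefficients of the homogeneous polynomial in the vector part\<close>

text \<open>
  The dehomogenization \<open>s = 1\<close>, \<open>v = X\<close> of \<open>\<Sum>\<^sub>j c\<^sub>j (s + v)^(k-j) (s - v)^j\<close>, with real coefficients.
\<close>

definition axial_poly :: "real \<Rightarrow> nat \<Rightarrow> real poly" where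
  "axial_poly b k = (\<Sum>j\<le>k. smult (vandermonde_term (b + 1) b k j) ([:1, 1:] ^ (k - j) * [:1, -1:] ^ j))"

text \<open>
  The operator on the left acts on \<open>t\<^sub>j = (1 + X)^(k-j) (1 - X)^j\<close> by \<open>t\<^sub>j \<mapsto> j (t\<^sub>j\<^sub>-\<^sub>1 - t\<^sub>j)\<close>, because
  \<open>2 X = (1 + X) - (1 - X)\<close> and \<open>2 = (1 + X) + (1 - X)\<close>, while \<open>X \<mapsto> - X\<close> exchanges \<open>t\<^sub>j\<close> with
  \<open>t\<^sub>k\<^sub>-\<^sub>j\<close>.  Comparing the factors of \<open>t\<^sub>j\<close> on both sides leaves the preceding identity.
\<close>

lemma axial_poly_functional_equation:
  "[:0, 1:] * (smult (real k) (axial_poly b k) - [:1, 1:] * pderiv (axial_poly b k)) =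
   smult b (axial_poly b k - pcompose (axial_poly b k) [:0, -1:])"
proof -
  let ?p = "[:1, 1:] :: real poly" and ?n = "[:1, -1:] :: real poly" and ?X = "[:0, 1:] :: real poly"
  let ?c = "vandermonde_term (b + 1) b k"
  define t where "t j = ?p ^ (k - j) * ?n ^ j" for j
  have X: "?X * (?n + ?p) = ?p - ?n" by simp
  have euler: "?X * (smult (real k) (t j) - ?p * pderiv (t j)) = smult (real j) (t (j - 1) - t j)"
    if "j \<le> k" for j
  proof -
    define l where "l = k - j"
    have k: "real k = real l + real j" using that by (simp add: l_def)
    have pd: "pderiv (?p ^ l) = smult (real l) (?p ^ (l - 1))" for l
      by (simp add: pderiv_power pderiv_pCons)
    have nd: "pderiv (?n ^ j) = smult (- real j) (?n ^ (j - 1))"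
      by (simp add: pderiv_power pderiv_pCons)
    have pl: "smult (real l) (?p * ?p ^ (l - 1)) = smult (real l) (?p ^ l)"
      by (cases l) simp_all
    have nj: "smult (real j) (?n * ?n ^ (j - 1)) = smult (real j) (?n ^ j)"
      by (cases j) simp_all
    have "?p * pderiv (t j) = smult (real l) (?p * ?p ^ (l - 1)) * ?n ^ j -
        smult (real j) (?p ^ Suc l * ?n ^ (j - 1))"
      unfolding t_def l_def [symmetric] pderiv_mult pd nd
      by (simp add: algebra_simps)
    also have "\<dots> = smult (real l) (t j) - smult (real j) (?p ^ Suc l * ?n ^ (j - 1))"
      unfolding pl by (simp add: t_def l_def)
    finally have "smult (real k) (t j) - ?p * pderiv (t j) =
        smult (real j) (t j) + smult (real j) (?p ^ Suc l * ?n ^ (j - 1))"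
      unfolding k by (simp add: smult_add_left)
    also have "smult (real j) (t j) = smult (real j) (?n * ?n ^ (j - 1)) * ?p ^ l"
      unfolding nj by (simp add: t_def l_def mult.commute)
    also have "\<dots> + smult (real j) (?p ^ Suc l * ?n ^ (j - 1)) =
        smult (real j) ((?n + ?p) * (?p ^ l * ?n ^ (j - 1)))"
      by (simp only: ring_distribs power_Suc smult_add_right mult_smult_left mult_smult_right mult_ac)
    finally have "?X * (smult (real k) (t j) - ?p * pderiv (t j)) =
        smult (real j) (?X * (?n + ?p) * (?p ^ l * ?n ^ (j - 1)))"
      by (simp only: mult_smult_right mult.assoc)
    also have "\<dots> = smult (real j) (?p ^ Suc l * ?n ^ (j - 1)) - smult (real j) (?n * ?n ^ (j - 1)) * ?p ^ l"
      unfolding X by (simp only: left_diff_distrib right_diff_distrib power_Suc smult_diff_right mult_smult_left mult_smult_right mult_ac)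
    also have "\<dots> = smult (real j) (t (j - 1)) - smult (real j) (t j)"
    proof (cases "j = 0")
      case False
      then have "Suc l = k - (j - 1)" using that by (simp add: l_def)
      then show ?thesis unfolding nj by (simp add: t_def l_def mult.commute)
    qed simp
    finally show ?thesis by (simp add: smult_diff_right)
  qed
  have q: "axial_poly b k = (\<Sum>j\<le>k. smult (?c j) (t j))" by (simp add: axial_poly_def t_def)
  have smult_sum2: "smult c (\<Sum>j\<in>J. f j) = (\<Sum>j\<in>J. smult c (f j))"
    for c and f :: "nat \<Rightarrow> real poly" and J
    by (induction J rule: infinite_finite_induct) (simp_all add: smult_add_right)
  have pcompose_power: "pcompose (p ^ n) r = pcompose p r ^ n" for p r :: "real poly" and n
    by (induction n) (simp_all add: pcompose_mult pcompose_1)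
  have pderiv_sum_t: "pderiv (\<Sum>j\<in>J. smult (?c j) (t j)) = (\<Sum>j\<in>J. smult (?c j) (pderiv (t j)))" for J
    by (induction J rule: infinite_finite_induct) (simp_all add: pderiv_add pderiv_smult)
  have "?X * (smult (real k) (axial_poly b k) - ?p * pderiv (axial_poly b k)) =
      (\<Sum>j\<le>k. smult (?c j) (?X * (smult (real k) (t j) - ?p * pderiv (t j))))"
    unfolding q pderiv_sum_t
    by (simp only: smult_sum2 sum_distrib_left sum_subtractf [symmetric] mult_smult_right
        smult_diff_right smult_smult mult.commute [of "real k"] right_diff_distrib)
  also have "\<dots> = (\<Sum>j\<le>k. smult (?c j * real j) (t (j - 1))) - (\<Sum>j\<le>k. smult (?c j * real j) (t j))"
    unfolding sum_subtractf [symmetric]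
    by (intro sum.cong refl) (simp only: euler atMost_iff smult_diff_right smult_smult)
  also have "(\<Sum>j\<le>k. smult (?c j * real j) (t (j - 1))) = (\<Sum>j\<le>Suc k. smult (?c j * real j) (t (j - 1)))"
    by (simp add: vandermonde_term_def)
  also have "\<dots> = (\<Sum>j\<le>k. smult (?c (Suc j) * real (Suc j)) (t j))"
    by (simp only: sum.atMost_Suc_shift) simp
  also have "\<dots> - (\<Sum>j\<le>k. smult (?c j * real j) (t j)) =
      (\<Sum>j\<le>k. smult (real (Suc j) * ?c (Suc j) - real j * ?c j) (t j))"
    by (simp add: sum_subtractf [symmetric] smult_diff_left mult.commute)
  also have "\<dots> = (\<Sum>j\<le>k. smult (b * (?c j - ?c (k - j))) (t j))"
    by (intro sum.cong refl) (subst vandermonde_term_exchange, auto)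
  also have "\<dots> = smult b (axial_poly b k - (\<Sum>j\<le>k. smult (?c (k - j)) (t j)))"
    by (simp add: q smult_sum2 sum_subtractf smult_diff_left smult_diff_right right_diff_distrib)
  also have "(\<Sum>j\<le>k. smult (?c (k - j)) (t j)) = (\<Sum>j\<le>k. smult (?c j) (t (k - j)))"
    by (rule sum.reindex_bij_witness [of _ "\<lambda>j. k - j" "\<lambda>j. k - j"]) auto
  also have "\<dots> = pcompose (axial_poly b k) [:0, -1:]"
    unfolding q pcompose_sum pcompose_smult
    by (intro sum.cong refl) (simp add: t_def pcompose_mult pcompose_power pcompose_pCons mult.commute)
  finally show ?thesis .
qed

text \<open>
  The term \<open>q(X) - q(-X)\<close> keeps the odd coefficients of \<open>q\<close> and doubles them, which turns \<open>b\<close> into the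
  summand \<open>2 b = m - 1\<close> of the weight for odd exponents.
\<close>

lemma axial_poly_coeff_rec:
  assumes "b = (real m - 1) / 2"
  shows "(real k - real i) * coeff (axial_poly b k) i = dirac_weight m (Suc i) * coeff (axial_poly b k) (Suc i)"
proof -
  let ?\<kappa> = "coeff (axial_poly b k)"
  have "coeff ([:1, 1:] * pderiv (axial_poly b k)) i = real (Suc i) * ?\<kappa> (Suc i) + real i * ?\<kappa> i"
    by (cases i) (simp_all add: coeff_pderiv coeff_pCons)
  then have "real k * ?\<kappa> i - (real (Suc i) * ?\<kappa> (Suc i) + real i * ?\<kappa> i) =
      coeff ([:0, 1:] * (smult (real k) (axial_poly b k) - [:1, 1:] * pderiv (axial_poly b k))) (Suc i)"
    by simp
  also have "\<dots> = b * (?\<kappa> (Suc i) - (- 1) ^ Suc i * ?\<kappa> (Suc i))"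
    unfolding axial_poly_functional_equation coeff_smult coeff_diff coeff_pcompose_linear ..
  finally have eq: "real k * ?\<kappa> i - (real (Suc i) * ?\<kappa> (Suc i) + real i * ?\<kappa> i) =
      b * (?\<kappa> (Suc i) - (- 1) ^ Suc i * ?\<kappa> (Suc i))" .
  have "real m - 1 = 2 * b" by (simp add: assms)
  then have "dirac_weight m (Suc i) = (if even i then real (Suc i) + 2 * b else real (Suc i))"
    by (simp add: dirac_weight_def)
  with eq show ?thesis by (cases "even i") (simp_all add: algebra_simps)
qed

lemma axial_poly_coeff_0: "coeff (axial_poly b k) 0 = pochhammer (2 * b + 1) k"
proof -
  have "coeff (axial_poly b k) 0 = (\<Sum>j\<le>k. vandermonde_term (b + 1) b k j)"
    by (simp add: axial_poly_def coeff_sum coeff_mult_0 coeff_0_power)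
  then show ?thesis by (simp add: vandermonde_sum)
qed

definition homogeneous_axial :: "(nat \<Rightarrow> real) \<Rightarrow> nat \<Rightarrow> 'n::{finite,linorder} point \<Rightarrow> (real, 'n) clifford" where
  "homogeneous_axial \<kappa> k x = (\<Sum>i\<le>k. (\<kappa> i * fst x ^ (k - i)) *\<^sub>R paravector (vec_part x) ^ i)"

lemma homogeneous_axial_mult_linear:
  fixes x :: "'n::{finite,linorder} point"
  assumes "degree q \<le> n"
  shows "(of_real (fst x) + c *\<^sub>R paravector (vec_part x)) * homogeneous_axial (coeff q) n x =
    homogeneous_axial (coeff ([:1, c:] * q)) (Suc n) x"
proof -
  let ?v = "paravector (vec_part x) :: (real, 'n) clifford" and ?s = "fst x"
  have q0: "coeff q (Suc n) = 0" using assms by (intro coeff_eq_0) simp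
  have "homogeneous_axial (coeff ([:1, c:] * q)) (Suc n) x =
      (\<Sum>i\<le>Suc n. (coeff q i * ?s ^ (Suc n - i)) *\<^sub>R ?v ^ i) +
      (\<Sum>i\<le>Suc n. (coeff (pCons 0 (smult c q)) i * ?s ^ (Suc n - i)) *\<^sub>R ?v ^ i)"
    by (simp only: homogeneous_axial_def sum.distrib [symmetric] scaleR_add_left [symmetric]
        distrib_right [symmetric] coeff_add [symmetric]) (simp add: mult_pCons_left)
  also have "(\<Sum>i\<le>Suc n. (coeff q i * ?s ^ (Suc n - i)) *\<^sub>R ?v ^ i) =
      of_real ?s * homogeneous_axial (coeff q) n x"
    using q0 by (simp add: homogeneous_axial_def sum_distrib_left of_real_def scaleR_sum_right Suc_diff_le mult_ac)
  also have "(\<Sum>i\<le>Suc n. (coeff (pCons 0 (smult c q)) i * ?s ^ (Suc n - i)) *\<^sub>R ?v ^ i) =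
      c *\<^sub>R ?v * homogeneous_axial (coeff q) n x"
    by (simp only: sum.atMost_Suc_shift)
       (simp add: homogeneous_axial_def sum_distrib_left scaleR_sum_right mult_ac)
  finally show ?thesis by (simp only: distrib_right)
qed

text \<open>
  The real part and the vector part commute, so a product of powers of \<open>x = s + v\<close> and of its conjugate
  \<open>s - v\<close> expands like the polynomial obtained by homogenizing the corresponding product of powers of
  \<open>1 + X\<close> and \<open>1 - X\<close>.
\<close>

lemma paravector_powers_homogeneous:
  fixes x :: "'n::{finite,linorder} point"
  shows "paravector x ^ p * paravector (conj_point x) ^ n =
    homogeneous_axial (coeff ([:1, 1:] ^ p * [:1, -1:] ^ n)) (p + n) x"
proof -
  let ?v = "paravector (vec_part x) :: (real, 'n) clifford" and ?s = "fst x"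
  have "conj_point x = (fst x, 0) + (- 1) *\<^sub>R vec_part x" by (simp add: conj_point_def vec_part_def)
  then have "paravector (conj_point x) = paravector (fst x, 0 :: (real, 'n) vec) + (- 1) *\<^sub>R ?v"
    by (simp only: linear_add [OF linear_paravector] linear_scale [OF linear_paravector])
  then have conj: "paravector (conj_point x) = of_real ?s + (- 1) *\<^sub>R ?v"
    by (simp add: paravector_def)
  have deg: "degree ([:1, 1:] ^ p * [:1, -1:] ^ n :: real poly) \<le> p + n" for p n
  proof -
    have "degree ([:1, 1:] ^ p :: real poly) \<le> p" "degree ([:1, -1:] ^ n :: real poly) \<le> n"
      using degree_power_le [of "[:1, 1:] :: real poly" p] degree_power_le [of "[:1, -1:] :: real poly" n] by simp_all
    then show ?thesis using degree_mult_le [of "[:1, 1:] ^ p :: real poly" "[:1, -1:] ^ n"] by linarith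
  qed
  show ?thesis
  proof (induction p)
    case 0
    show ?case
    proof (induction n)
      case 0
      then show ?case by (simp add: homogeneous_axial_def)
    next
      case (Suc n)
      then show ?case
        using homogeneous_axial_mult_linear [OF deg [of 0 n, unfolded power_0 mult_1 add_0], of x "- 1"]
        by (simp only: conj power_0 mult_1 add_0 power_Suc)
    qed
  next
    case (Suc p)
    then show ?case
      using homogeneous_axial_mult_linear [OF deg [of p n], of x 1]
      by (simp add: mult.assoc paravector_split [symmetric] del: mult_pCons_left)
  qed
qed

lemma Q_poly_binomial_sum:
  fixes x :: "'n::{finite,linorder} point"
  defines "b \<equiv> (real CARD('n) - 1) / 2"
  shows "pochhammer (real CARD('n)) k *\<^sub>R Q_poly k x = (\<Sum>j\<le>k. vandermonde_term (b + 1) b k j *\<^sub>R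
      (paravector x ^ (k - j) * paravector (conj_point x) ^ j))"
proof -
  let ?m = "real CARD('n)"
  have b: "(?m + 1) / 2 = b + 1" "(?m - 1) / 2 = b" by (simp_all add: b_def field_simps)
  have "?m > 0" by simp
  then have "pochhammer ?m k \<noteq> 0" using pochhammer_pos [of ?m k] by linarith
  then have T: "pochhammer ?m k * T_coeff CARD('n) k j = vandermonde_term (b + 1) b k j" if "j \<le> k" for j
    using that unfolding T_coeff_def b vandermonde_term_def by (simp add: binomial_fact mult_ac)
  show ?thesis
    unfolding Q_poly_def scaleR_sum_right atLeast0AtMost by (intro sum.cong) (simp_all add: T)
qed

lemma Q_poly_homogeneous:
  fixes x :: "'n::{finite,linorder} point"
  defines "b \<equiv> (real CARD('n) - 1) / 2"
  shows "pochhammer (real CARD('n)) k *\<^sub>R Q_poly k x = homogeneous_axial (coeff (axial_poly b k)) k x"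
proof -
  have "pochhammer (real CARD('n)) k *\<^sub>R Q_poly k x = (\<Sum>j\<le>k. vandermonde_term (b + 1) b k j *\<^sub>R
      homogeneous_axial (coeff ([:1, 1:] ^ (k - j) * [:1, -1:] ^ j)) k x)"
    unfolding Q_poly_binomial_sum b_def paravector_powers_homogeneous by (intro sum.cong) auto
  also have "\<dots> = homogeneous_axial (coeff (axial_poly b k)) k x"
    unfolding homogeneous_axial_def axial_poly_def coeff_sum coeff_smult sum_distrib_right scaleR_sum_left
    by (subst sum.swap) (simp add: scaleR_sum_right mult.assoc)
  finally show ?thesis .
qed

section \<open>The generalized CK extension of a monomial\<close>

text \<open>
  Since \<open>v\<^sup>2 = - |v|\<^sup>2\<close>, even powers of \<open>v\<close> are real scalars \<open>(- |v|\<^sup>2)^l\<close> and odd powers are such scalars times \<open>v\<close>.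
  Differentiating the scalar yields \<open>\<Sum>\<^sub>j v\<^sub>j e\<^sub>j = v\<close>; for odd powers the factor \<open>v\<close> adds
  \<open>\<Sum>\<^sub>j e\<^sub>j\<^sup>2 = - m\<close>.
\<close>

lemma has_vector_derivative_vec_part_power:
  fixes x :: "'n::{finite,linorder} point"
  defines "v \<equiv> \<lambda>x. paravector (vec_part x) :: (real, 'n) clifford"
  obtains d where
    "\<And>j. ((\<lambda>\<tau>. v (x + \<tau> *\<^sub>R (0, axis j 1)) ^ i) has_vector_derivative d j) (at 0)"
    "(\<Sum>j\<in>UNIV. clifford_gen j * d j) = - (dirac_weight CARD('n) i *\<^sub>R v x ^ (i - 1))"
proof -
  let ?e = "clifford_gen :: 'n \<Rightarrow> (real, 'n) clifford"
  define N where "N x = - (norm (snd x))\<^sup>2" for x :: "'n point"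
  define l where "l = i div 2"
  define q where "q j = real l * (N x ^ (l - 1) * (- 2 * snd x $ j))" for j
  have sq: "v y * v y = of_real (N y)" for y
    by (simp add: v_def N_def paravector_vec_part_square)
  have even_power: "v y ^ (2 * n) = N y ^ n *\<^sub>R 1" for y n
    by (induction n) (simp_all add: mult.assoc [symmetric] sq of_real_def)
  have v_lin: "v (x + \<tau> *\<^sub>R (0, axis j 1)) = v x + \<tau> *\<^sub>R ?e j" for \<tau> j
  proof -
    have "vec_part (x + \<tau> *\<^sub>R (0, axis j 1)) = vec_part x + (0, \<tau> *\<^sub>R axis j 1)" by (simp add: vec_part_def)
    then show ?thesis by (simp add: v_def linear_add [OF linear_paravector] paravector_axis)
  qed
  have dv: "((\<lambda>\<tau>. v (x + \<tau> *\<^sub>R (0, axis j 1))) has_vector_derivative ?e j) (at 0)" for j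
    unfolding v_lin by (auto intro!: derivative_eq_intros)
  have N_quad: "N (x + \<tau> *\<^sub>R (0, axis j 1)) = N x - 2 * \<tau> * snd x $ j - \<tau>\<^sup>2" for \<tau> j
  proof -
    have "N (x + \<tau> *\<^sub>R (0, axis j 1)) = - ((snd x + \<tau> *\<^sub>R axis j 1) \<bullet> (snd x + \<tau> *\<^sub>R axis j 1))"
      by (simp only: N_def power2_norm_eq_inner snd_add snd_scaleR snd_conv)
    also have "\<dots> = - (snd x \<bullet> snd x) - 2 * \<tau> * snd x $ j - \<tau>\<^sup>2"
      by (simp add: inner_add_left inner_add_right inner_axis inner_axis' power2_eq_square algebra_simps)
    finally show ?thesis by (simp only: N_def power2_norm_eq_inner)
  qed
  have dN: "((\<lambda>\<tau>. N (x + \<tau> *\<^sub>R (0, axis j 1)) ^ l) has_vector_derivative q j) (at 0)" for j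
    unfolding N_quad has_real_derivative_iff_has_vector_derivative [symmetric] q_def
    by (auto intro!: derivative_eq_intros)
  have sum_q: "(\<Sum>j\<in>UNIV. q j *\<^sub>R ?e j) = - ((2 * real l * N x ^ (l - 1)) *\<^sub>R v x)"
    by (simp add: sum_negf v_def paravector_def vec_part_def q_def scaleR_sum_right mult_ac)
  show ?thesis
  proof (cases "even i")
    case True
    then have i: "i = 2 * l" by (simp add: l_def)
    show ?thesis
    proof (rule that [of "\<lambda>j. q j *\<^sub>R 1"])
      show "((\<lambda>\<tau>. v (x + \<tau> *\<^sub>R (0, axis j 1)) ^ i) has_vector_derivative q j *\<^sub>R 1) (at 0)" for j
        unfolding i even_power using dN
        by (rule bounded_linear.has_vector_derivative [OF bounded_linear_scaleR_left])
      show "(\<Sum>j\<in>UNIV. ?e j * q j *\<^sub>R 1) = - (dirac_weight CARD('n) i *\<^sub>R v x ^ (i - 1))"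
      proof (cases l)
        case (Suc n)
        then have "i - 1 = Suc (2 * n)" using i by simp
        then show ?thesis
          using sum_q Suc i by (simp add: even_power dirac_weight_def power_commutes)
      qed (use sum_q i in \<open>simp add: dirac_weight_def\<close>)
    qed
  next
    case False
    then have i: "i = Suc (2 * l)" by (simp add: l_def)
    show ?thesis
    proof (rule that [of "\<lambda>j. N x ^ l *\<^sub>R ?e j + q j *\<^sub>R v x"])
      have "((\<lambda>\<tau>. N (x + \<tau> *\<^sub>R (0, axis j 1)) ^ l *\<^sub>R v (x + \<tau> *\<^sub>R (0, axis j 1))) has_vector_derivative
          N (x + 0 *\<^sub>R (0, axis j 1)) ^ l *\<^sub>R ?e j + q j *\<^sub>R v (x + 0 *\<^sub>R (0, axis j 1))) (at 0)" for j
        by (rule bounded_bilinear.has_vector_derivative [OF bounded_bilinear_scaleR dN dv])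
      moreover have "v y ^ i = N y ^ l *\<^sub>R v y" for y
        unfolding i power_Suc2 even_power by simp
      ultimately show "((\<lambda>\<tau>. v (x + \<tau> *\<^sub>R (0, axis j 1)) ^ i) has_vector_derivative
          N x ^ l *\<^sub>R ?e j + q j *\<^sub>R v x) (at 0)" for j
        by (simp only: scaleR_zero_left add_0_right)
      have "(\<Sum>j\<in>UNIV. ?e j * (N x ^ l *\<^sub>R ?e j + q j *\<^sub>R v x)) =
          (\<Sum>j\<in>(UNIV :: 'n set). - (N x ^ l *\<^sub>R 1)) + (\<Sum>j\<in>UNIV. q j *\<^sub>R ?e j) * v x"
        by (simp only: distrib_left sum.distrib mult_scaleR_right mult_scaleR_left clifford_gen_square
            sum_distrib_right scaleR_minus_right)
      also have "(\<Sum>j\<in>(UNIV :: 'n set). - (N x ^ l *\<^sub>R 1)) = - ((real CARD('n) * N x ^ l) *\<^sub>R (1 :: (real, 'n) clifford))"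
        by (simp add: sum_constant_scaleR del: sum_constant)
      finally have "(\<Sum>j\<in>UNIV. ?e j * (N x ^ l *\<^sub>R ?e j + q j *\<^sub>R v x)) =
          - ((real CARD('n) * N x ^ l) *\<^sub>R 1) + (\<Sum>j\<in>UNIV. q j *\<^sub>R ?e j) * v x" .
      moreover have "(\<Sum>j\<in>UNIV. q j *\<^sub>R ?e j) * v x = - ((2 * real l * N x ^ l) *\<^sub>R 1)"
        unfolding sum_q by (cases l) (simp_all add: sq of_real_def mult_ac)
      moreover have "dirac_weight CARD('n) i = real CARD('n) + 2 * real l"
        by (simp add: dirac_weight_def i)
      moreover have "v x ^ (i - 1) = N x ^ l *\<^sub>R 1"
        by (simp add: i even_power)
      ultimately show "(\<Sum>j\<in>UNIV. ?e j * (N x ^ l *\<^sub>R ?e j + q j *\<^sub>R v x)) =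
          - (dirac_weight CARD('n) i *\<^sub>R v x ^ (i - 1))"
        by (simp add: scaleR_add_left distrib_right)
    qed
  qed
qed

lemma monogenic_homogeneous_axial:
  assumes rec: "\<And>i. i < k \<Longrightarrow> (real k - real i) * \<kappa> i = dirac_weight CARD('n) (Suc i) * \<kappa> (Suc i)"
  shows "monogenic (homogeneous_axial \<kappa> k :: 'n::{finite,linorder} point \<Rightarrow> _)"
  unfolding monogenic_def
proof
  fix x :: "'n point"
  define v where "v y = (paravector (vec_part y) :: (real, 'n) clifford)" for y
  let ?s = "fst x" and ?F = "homogeneous_axial \<kappa> k :: 'n point \<Rightarrow> _"
  define P where "P i d \<longleftrightarrow> (\<forall>j. ((\<lambda>\<tau>. v (x + \<tau> *\<^sub>R (0, axis j 1)) ^ i) has_vector_derivative d j) (at 0)) \<and>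
    (\<Sum>j\<in>UNIV. clifford_gen j * d j) = - (dirac_weight CARD('n) i *\<^sub>R v x ^ (i - 1))" for i d
  have "\<exists>d. P i d" for i
    unfolding v_def P_def by (rule has_vector_derivative_vec_part_power [of x i]) blast
  then obtain d where "\<And>i. P i (d i)" by metis
  then have d: "((\<lambda>\<tau>. v (x + \<tau> *\<^sub>R (0, axis j 1)) ^ i) has_vector_derivative d i j) (at 0)"
    and sum_d: "(\<Sum>j\<in>UNIV. clifford_gen j * d i j) = - (dirac_weight CARD('n) i *\<^sub>R v x ^ (i - 1))" for i j
    by (simp_all add: P_def)
  have pj: "partial_deriv (0, axis j 1) ?F x = (\<Sum>i\<le>k. (\<kappa> i * ?s ^ (k - i)) *\<^sub>R d i j)" for j
    unfolding partial_deriv_def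
  proof (rule vector_derivative_at)
    show "((\<lambda>\<tau>. ?F (x + \<tau> *\<^sub>R (0, axis j 1))) has_vector_derivative
        (\<Sum>i\<le>k. (\<kappa> i * ?s ^ (k - i)) *\<^sub>R d i j)) (at 0)"
      unfolding homogeneous_axial_def v_def [symmetric]
      using bounded_linear.has_vector_derivative [OF bounded_linear_scaleR_right d]
      by (intro has_vector_derivative_sum) simp
  qed
  have p0: "partial_x0 ?F x = (\<Sum>i\<le>k. (\<kappa> i * (real (k - i) * ?s ^ (k - i - 1))) *\<^sub>R v x ^ i)"
    unfolding partial_deriv_def
  proof (rule vector_derivative_at)
    have "((\<lambda>\<tau>. \<kappa> i * (?s + \<tau>) ^ (k - i)) has_vector_derivative \<kappa> i * (real (k - i) * ?s ^ (k - i - 1))) (at 0)" for i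
      unfolding has_real_derivative_iff_has_vector_derivative [symmetric]
      by (auto intro!: derivative_eq_intros)
    then have "((\<lambda>\<tau>. \<Sum>i\<le>k. (\<kappa> i * (?s + \<tau>) ^ (k - i)) *\<^sub>R v x ^ i) has_vector_derivative
        (\<Sum>i\<le>k. (\<kappa> i * (real (k - i) * ?s ^ (k - i - 1))) *\<^sub>R v x ^ i)) (at 0)"
      by (intro has_vector_derivative_sum bounded_linear.has_vector_derivative [OF bounded_linear_scaleR_left])
    then show "((\<lambda>\<tau>. ?F (x + \<tau> *\<^sub>R (1, 0))) has_vector_derivative
        (\<Sum>i\<le>k. (\<kappa> i * (real (k - i) * ?s ^ (k - i - 1))) *\<^sub>R v x ^ i)) (at 0)"
      by (simp add: homogeneous_axial_def v_def vec_part_def)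
  qed
  have "(\<Sum>j\<in>UNIV. clifford_gen j * partial_deriv (0, axis j 1) ?F x) =
      (\<Sum>i\<le>k. (\<kappa> i * ?s ^ (k - i)) *\<^sub>R (\<Sum>j\<in>UNIV. clifford_gen j * d i j))"
    unfolding pj sum_distrib_left mult_scaleR_right scaleR_sum_right by (rule sum.swap)
  also have "\<dots> = - (\<Sum>i\<le>k. (\<kappa> i * ?s ^ (k - i) * dirac_weight CARD('n) i) *\<^sub>R v x ^ (i - 1))"
    by (simp add: sum_d sum_negf)
  also have "(\<Sum>i\<le>k. (\<kappa> i * ?s ^ (k - i) * dirac_weight CARD('n) i) *\<^sub>R v x ^ (i - 1)) =
      (\<Sum>i<k. (\<kappa> (Suc i) * ?s ^ (k - Suc i) * dirac_weight CARD('n) (Suc i)) *\<^sub>R v x ^ i)"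
    by (simp add: lessThan_Suc_atMost [symmetric] sum.lessThan_Suc_shift dirac_weight_def del: sum.lessThan_Suc)
  also have "\<dots> = (\<Sum>i<k. (\<kappa> i * (real (k - i) * ?s ^ (k - i - 1))) *\<^sub>R v x ^ i)"
  proof (intro sum.cong refl)
    fix i assume "i \<in> {..<k}"
    then have "i < k" by simp
    with rec [OF this]
    have "\<kappa> (Suc i) * ?s ^ (k - Suc i) * dirac_weight CARD('n) (Suc i) = \<kappa> i * (real (k - i) * ?s ^ (k - i - 1))"
      by (simp add: of_nat_diff mult_ac)
    then show "(\<kappa> (Suc i) * ?s ^ (k - Suc i) * dirac_weight CARD('n) (Suc i)) *\<^sub>R v x ^ i =
        (\<kappa> i * (real (k - i) * ?s ^ (k - i - 1))) *\<^sub>R v x ^ i" by simp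
  qed
  also have "\<dots> = (\<Sum>i\<le>k. (\<kappa> i * (real (k - i) * ?s ^ (k - i - 1))) *\<^sub>R v x ^ i)"
    by (simp add: lessThan_Suc_atMost [symmetric])
  finally show "partial_x0 ?F x + (\<Sum>j\<in>UNIV. clifford_gen j * partial_deriv (0, axis j 1) ?F x) = 0"
    by (simp add: p0)
qed

text \<open>
  \<open>A\<close> collects the even powers of \<open>v\<close>, and \<open>B\<close> the odd ones with the factor \<open>v\<close> replaced by its length.
\<close>

lemma axial_form_homogeneous_axial:
  "axial_form (homogeneous_axial \<kappa> k :: 'n::{finite,linorder} point \<Rightarrow> _)"
proof -
  define p :: "nat \<Rightarrow> real \<Rightarrow> real" where "p l r = (- (r\<^sup>2)) ^ l" for l r
  define A :: "real \<Rightarrow> real \<Rightarrow> (real, 'n) clifford" where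
    "A s r = (\<Sum>i\<le>k. (if even i then \<kappa> i * s ^ (k - i) * p (i div 2) r else 0) *\<^sub>R 1)" for s r
  define B :: "real \<Rightarrow> real \<Rightarrow> (real, 'n) clifford" where
    "B s r = r *\<^sub>R (\<Sum>i\<le>k. (if odd i then \<kappa> i * s ^ (k - i) * p (i div 2) r else 0) *\<^sub>R 1)" for s r
  have p_even: "p l (- r) = p l r" for l r by (simp add: p_def)
  have "homogeneous_axial \<kappa> k x = A (fst x) (norm (snd x)) +
      (1 / norm (snd x)) *\<^sub>R paravector (vec_part x) * B (fst x) (norm (snd x))" for x :: "'n point"
  proof -
    let ?v = "paravector (vec_part x) :: (real, 'n) clifford" and ?r = "norm (snd x)"
    have even: "?v ^ (2 * l) = p l ?r *\<^sub>R 1" for l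
      by (induction l) (simp_all add: p_def mult.assoc [symmetric] paravector_vec_part_square of_real_def)
    have power: "?v ^ i = (if even i then p (i div 2) ?r else 0) *\<^sub>R 1 +
        ?v * (if odd i then p (i div 2) ?r else 0) *\<^sub>R 1" for i
      using even by (cases "even i") (auto elim!: evenE oddE)
    have v0: "(1 / ?r) *\<^sub>R ?v * (?r *\<^sub>R a) = ?v * a" for a
    proof (cases "?r = 0")
      case True
      then have "vec_part x = 0" by (simp add: vec_part_def zero_prod_def)
      then show ?thesis by (simp add: linear_0 [OF linear_paravector])
    qed simp
    show ?thesis
      unfolding homogeneous_axial_def A_def B_def v0 sum_distrib_left sum.distrib [symmetric]
      by (intro sum.cong refl, subst power) (simp add: scaleR_add_right)
  qed
  moreover have "A s (- r) = A s r" "B s (- r) = - B s r" for s r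
    by (simp_all add: A_def B_def p_even cong: if_cong)
  ultimately show ?thesis unfolding axial_form_def by blast
qed

lemma real_analytic_homogeneous_axial:
  "real_analytic (homogeneous_axial \<kappa> k :: 'n::{finite,linorder} point \<Rightarrow> _)"
proof -
  have fst_mult: "real_analytic (\<lambda>x. fst x *\<^sub>R F x)" if "real_analytic F" for F :: "'n point \<Rightarrow> (real, 'n) clifford"
    using real_analytic_coord [OF that, of "(1, 0)"] by (simp add: Basis_prod_def inner_prod_def)
  have v_mult: "real_analytic (\<lambda>x. paravector (vec_part x) * F x)" if "real_analytic F" for F :: "'n point \<Rightarrow> (real, 'n) clifford"
  proof -
    have "real_analytic (\<lambda>x. \<Sum>j\<in>UNIV. (x \<bullet> (0, axis j 1)) *\<^sub>R (clifford_gen j * F x))"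
      by (intro real_analytic_sum real_analytic_coord
            real_analytic_bounded_linear [OF bounded_linear_clifford_mult_left] that)
         (simp add: Basis_prod_def axis_in_Basis_iff)
    then show ?thesis
      by (simp add: paravector_def vec_part_def sum_distrib_right inner_prod_def inner_axis)
  qed
  have v_pow: "real_analytic (\<lambda>x. paravector (vec_part x) ^ n :: (real, 'n) clifford)" for n
    by (induction n) (use v_mult in \<open>auto intro: real_analytic_const\<close>)
  have monomial: "real_analytic (\<lambda>x. fst x ^ n *\<^sub>R (c *\<^sub>R paravector (vec_part x) ^ i :: (real, 'n) clifford))" for n c i
  proof (induction n)
    case 0
    show ?case using real_analytic_bounded_linear [OF bounded_linear_scaleR_right v_pow] by simp
  next
    case (Suc n)
    from fst_mult [OF this] show ?case by (simp only: scaleR_scaleR power_Suc mult.assoc)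
  qed
  show ?thesis
    unfolding homogeneous_axial_def using monomial
    by (intro real_analytic_sum) (simp add: mult.commute)
qed

lemma real_analytic_monomial: "real_analytic (\<lambda>s::real. s ^ n *\<^sub>R c)"
proof (induction n)
  case (Suc n)
  then show ?case using real_analytic_coord [OF Suc, of 1] by simp
qed (simp add: real_analytic_const)

text \<open>
  The polynomial is an admissible extension, with finitely many nonzero \<open>f\<^sub>j\<close>, and the definite description in the
  definition of the extension is resolved by uniqueness.
\<close>

lemma GCK_monomial:
  assumes rec: "\<And>i. i < k \<Longrightarrow> (real k - real i) * \<kappa> i = dirac_weight CARD('n) (Suc i) * \<kappa> (Suc i)"
  shows "GCK (\<lambda>t. of_real (\<kappa> 0 * t ^ k)) = (homogeneous_axial \<kappa> k :: 'n::{finite,linorder} point \<Rightarrow> _)"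
proof -
  let ?F = "homogeneous_axial \<kappa> k :: 'n point \<Rightarrow> _"
  define f :: "nat \<Rightarrow> real \<Rightarrow> (real, 'n) clifford" where
    "f j s = s ^ (k - j) *\<^sub>R (if j \<le> k then \<kappa> j *\<^sub>R 1 else 0)" for j s
  have mono: "axially_monogenic ?F"
    unfolding axially_monogenic_def
    using real_analytic_homogeneous_axial monogenic_homogeneous_axial [OF rec] axial_form_homogeneous_axial
    by blast
  have f_analytic: "real_analytic (f j)" for j
    unfolding f_def [abs_def] by (rule real_analytic_monomial)
  have f_sums: "(\<lambda>j. paravector (vec_part x) ^ j * f j (fst x)) sums ?F x" for x
  proof -
    have "(\<lambda>j. paravector (vec_part x) ^ j * f j (fst x)) sums (\<Sum>j\<le>k. paravector (vec_part x) ^ j * f j (fst x))"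
      by (rule sums_finite) (auto simp: f_def)
    also have "(\<Sum>j\<le>k. paravector (vec_part x) ^ j * f j (fst x)) = ?F x"
      unfolding homogeneous_axial_def by (intro sum.cong) (auto simp: f_def mult.commute)
    finally show ?thesis .
  qed
  have axis: "?F (s, 0) = of_real (\<kappa> 0 * s ^ k)" for s
  proof -
    have v0: "paravector (vec_part (s, 0 :: (real, 'n) vec)) = (0 :: (real, 'n) clifford)"
      by (simp add: vec_part_def paravector_def)
    show ?thesis
      unfolding homogeneous_axial_def v0
      by (simp add: power_0_left of_real_def if_distrib [of "\<lambda>a. _ *\<^sub>R a"] cong: if_cong)
  qed
  show ?thesis
    unfolding GCK_def
  proof (rule the_equality)
    show "axially_monogenic ?F \<and>
      (\<exists>f. (\<forall>j. real_analytic (f j)) \<and> (\<forall>x. (\<lambda>j. paravector (vec_part x) ^ j * f j (fst x)) sums ?F x)) \<and>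
      (\<forall>s. ?F (s, 0) = of_real (\<kappa> 0 * s ^ k))"
      using mono f_analytic f_sums axis by blast
  next
    fix G :: "'n point \<Rightarrow> (real, 'n) clifford"
    assume G: "axially_monogenic G \<and>
      (\<exists>f. (\<forall>j. real_analytic (f j)) \<and> (\<forall>x. (\<lambda>j. paravector (vec_part x) ^ j * f j (fst x)) sums G x)) \<and>
      (\<forall>s. G (s, 0) = of_real (\<kappa> 0 * s ^ k))"
    then obtain g where "\<And>x. (\<lambda>j. paravector (vec_part x) ^ j * g j (fst x)) sums G x" by blast
    then show "G = ?F"
      using G mono f_sums axis by (intro gck_extension_unique [of G g ?F f]) auto
  qed
qed

lemma GCK_Q_poly:
  "GCK (\<lambda>t. of_real (c * t ^ k)) = (\<lambda>x :: 'n::{finite,linorder} point. c *\<^sub>R Q_poly k x)"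
proof -
  let ?m = "real CARD('n)" and ?b = "(real CARD('n) - 1) / 2"
  define \<kappa> where "\<kappa> i = c / pochhammer ?m k * coeff (axial_poly ?b k) i" for i
  have "?m > 0" by simp
  then have nz: "pochhammer ?m k \<noteq> 0" using pochhammer_pos [of ?m k] by linarith
  have "2 * ?b + 1 = ?m" by (simp add: field_simps)
  then have \<kappa>0: "\<kappa> 0 = c" using nz unfolding \<kappa>_def axial_poly_coeff_0 by (simp only:) simp
  have "(real k - real i) * \<kappa> i = dirac_weight CARD('n) (Suc i) * \<kappa> (Suc i)" for i
    using axial_poly_coeff_rec [of ?b "CARD('n)" k i] by (simp add: \<kappa>_def)
  from GCK_monomial [of k \<kappa>, OF this]
  have "GCK (\<lambda>t. of_real (c * t ^ k)) = (homogeneous_axial \<kappa> k :: 'n point \<Rightarrow> _)" by (simp add: \<kappa>0)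
  also have "\<dots> = (\<lambda>x. c *\<^sub>R Q_poly k x)"
  proof
    fix x :: "'n point"
    have "homogeneous_axial \<kappa> k x = (c / pochhammer ?m k) *\<^sub>R homogeneous_axial (coeff (axial_poly ?b k)) k x"
      by (simp add: homogeneous_axial_def \<kappa>_def scaleR_sum_right mult.assoc)
    also have "\<dots> = c *\<^sub>R Q_poly k x"
      unfolding Q_poly_homogeneous [symmetric] using nz by simp
    finally show "homogeneous_axial \<kappa> k x = c *\<^sub>R Q_poly k x" .
  qed
  finally show ?thesis .
qed

lemma higher_deriv_monomial:
  "(deriv_op ^^ n) (\<lambda>t. of_real (t ^ (n + k))) =
     (\<lambda>t. of_real (fact (n + k) / fact k * t ^ k) :: (real, 'n::{finite,linorder}) clifford)"
proof -
  have step: "deriv_op (\<lambda>t. of_real (c * t ^ Suc k)) =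
     (\<lambda>t. of_real (c * real (Suc k) * t ^ k) :: (real, 'n) clifford)" for c k
  proof
    fix t :: real
    have "((\<lambda>t. c * t ^ Suc k) has_vector_derivative c * (real (Suc k) * t ^ k)) (at t)"
      unfolding has_real_derivative_iff_has_vector_derivative [symmetric]
      by (rule derivative_eq_intros refl | simp)+
    then have "((\<lambda>t. of_real (c * t ^ Suc k) :: (real, 'n) clifford) has_vector_derivative
        of_real (c * (real (Suc k) * t ^ k))) (at t)"
      unfolding of_real_def by (rule bounded_linear.has_vector_derivative [OF bounded_linear_scaleR_left])
    then show "deriv_op (\<lambda>t. of_real (c * t ^ Suc k)) t = (of_real (c * real (Suc k) * t ^ k) :: (real, 'n) clifford)"
      by (simp only: vector_derivative_at mult.assoc)
  qed
  have "(deriv_op ^^ n) (\<lambda>t. of_real (c * t ^ (n + k))) =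
     (\<lambda>t. of_real (c * (fact (n + k) / fact k) * t ^ k) :: (real, 'n) clifford)" for c
  proof (induction n arbitrary: c)
    case (Suc n)
    have "(deriv_op ^^ Suc n) (\<lambda>t. of_real (c * t ^ (Suc n + k)) :: (real, 'n) clifford) =
        (deriv_op ^^ n) (deriv_op (\<lambda>t. of_real (c * t ^ Suc (n + k))))"
      by (simp only: funpow_Suc_right o_apply add_Suc)
    also have "\<dots> = (\<lambda>t. of_real (c * real (Suc (n + k)) * (fact (n + k) / fact k) * t ^ k))"
      unfolding step by (rule Suc.IH)
    finally show ?case by (simp add: mult_ac del: of_nat_Suc)
  qed simp
  from this [of 1] show ?thesis by simp
qed

section \<open>The derivatives of the Cauchy kernel and their Kelvin inversion\<close>

lemma has_vector_derivative_clifford_mult: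
  fixes f g :: "real \<Rightarrow> (real, 'n::{finite,linorder}) clifford"
  assumes "(f has_vector_derivative f') (at t)" "(g has_vector_derivative g') (at t)"
  shows "((\<lambda>t. f t * g t) has_vector_derivative f t * g' + f' * g t) (at t)"
  by (rule bounded_bilinear.has_vector_derivative [OF bounded_bilinear_clifford_mult assms])

lemma has_vector_derivative_real_shift_power:
  fixes a :: "(real, 'n::{finite,linorder}) clifford"
  shows "((\<lambda>t. (a + of_real t) ^ n) has_vector_derivative real n *\<^sub>R a ^ (n - 1)) (at 0)"
proof (induction n)
  case (Suc n)
  have "((\<lambda>t. a + of_real t) has_vector_derivative 1) (at 0)"
    unfolding of_real_def by (auto intro!: derivative_eq_intros)
  from has_vector_derivative_clifford_mult [OF this Suc]
  have "((\<lambda>t. (a + of_real t) ^ Suc n) has_vector_derivative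
      (a + of_real 0) * (real n *\<^sub>R a ^ (n - 1)) + 1 * (a + of_real 0) ^ n) (at 0)"
    by (simp only: power_Suc)
  also have "(a + of_real 0) * (real n *\<^sub>R a ^ (n - 1)) + 1 * (a + of_real 0) ^ n =
      real (Suc n) *\<^sub>R a ^ (Suc n - 1)"
    by (cases n) (simp_all add: distrib_left scaleR_add_left scaleR_2)
  finally show ?case .
qed simp

lemma conj_point_scaleR: "conj_point (c *\<^sub>R x) = c *\<^sub>R conj_point x"
  by (simp add: conj_point_def)

lemma norm_conj_point [simp]: "norm (conj_point x) = norm x"
  by (simp add: conj_point_def norm_prod_def)

lemma conj_conj_point [simp]: "conj_point (conj_point x) = x"
  by (simp add: conj_point_def)

lemma paravector_mult_conj_commute:
  "paravector (conj_point x) * paravector x = (paravector x * paravector (conj_point x) :: (real, 'n::{finite,linorder}) clifford)"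
  using paravector_mult_conj [of x, where ?'k = real] paravector_mult_conj [of "conj_point x", where ?'k = real]
  by simp

lemma paravector_add_conj:
  "paravector x + paravector (conj_point x) = (of_real (2 * fst x) :: (real, 'n::{finite,linorder}) clifford)"
proof -
  have "x + conj_point x = (2 * fst x, 0 *\<^sub>R axis (undefined :: 'n) 1)" by (simp add: conj_point_def prod_eq_iff)
  then show ?thesis
    by (simp only: linear_add [OF linear_paravector, symmetric] paravector_axis) simp
qed

text \<open>
  With \<open>X = x\<close> and \<open>Y = conj(x)\<close>, the derivative of \<open>|x|^(-N)\<close> contributes \<open>- N x\<^sub>0 |x|^(-N-2)\<close>.  Writing
  \<open>x\<^sub>0 = (X + Y) / 2\<close> and \<open>|x|\<^sup>2 = X Y\<close> brings the three summands of the product rule to the common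
  denominator \<open>|x|^(N+2)\<close>.
\<close>

lemma partial_x0_axial_term:
  fixes x :: "'n::{finite,linorder} point" and p q N :: nat
  assumes "x \<noteq> 0"
  defines "X \<equiv> paravector x :: (real, 'n) clifford" and "Y \<equiv> paravector (conj_point x)"
  shows "((\<lambda>t. (1 / norm (x + t *\<^sub>R (1, 0)) ^ N) *\<^sub>R
      (paravector (conj_point (x + t *\<^sub>R (1, 0))) ^ p * paravector (x + t *\<^sub>R (1, 0)) ^ q))
    has_vector_derivative (1 / norm x ^ (N + 2)) *\<^sub>R
      ((real p - real N / 2) *\<^sub>R (Y ^ p * X ^ Suc q) + (real q - real N / 2) *\<^sub>R (Y ^ Suc p * X ^ q))) (at 0)"
proof -
  let ?r = "norm x"
  have r: "?r > 0" using assms(1) by simp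
  have comm: "Y * X = X * Y" by (simp add: X_def Y_def paravector_mult_conj_commute)
  have Y_pow: "Y ^ n * X = X * Y ^ n" for n
    using power_commuting_commutes [OF comm, of n] by simp
  have XY: "X * Y = ?r\<^sup>2 *\<^sub>R 1" by (simp add: X_def Y_def paravector_mult_conj of_real_def)
  have X_plus_Y: "X + Y = (2 * fst x) *\<^sub>R 1" by (simp add: X_def Y_def paravector_add_conj of_real_def)
  have shift: "paravector (x + t *\<^sub>R (1, 0)) = X + of_real t" for t
    by (simp add: X_def paravector_def)
  have shift': "paravector (conj_point (x + t *\<^sub>R (1, 0))) = Y + of_real t" for t
    by (simp add: Y_def paravector_def conj_point_def)
  have dn: "((\<lambda>t. 1 / norm (x + t *\<^sub>R (1, 0)) ^ N) has_real_derivative - real N * fst x / ?r ^ (N + 2)) (at 0)"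
  proof -
    have eq: "norm (x + t *\<^sub>R (1, 0)) = sqrt ((fst x + t)\<^sup>2 + (norm (snd x))\<^sup>2)" for t
      by (simp add: norm_prod_def)
    have r_eq: "?r = sqrt ((fst x)\<^sup>2 + (norm (snd x))\<^sup>2)" by (simp add: norm_prod_def)
    have pos: "(fst x)\<^sup>2 + (norm (snd x))\<^sup>2 > 0" using r unfolding r_eq by simp
    have d1: "((\<lambda>t. norm (x + t *\<^sub>R (1, 0))) has_real_derivative fst x / ?r) (at 0)"
      unfolding eq r_eq using pos by (auto intro!: derivative_eq_intros simp: field_simps)
    define \<nu> where "\<nu> t = norm (x + t *\<^sub>R (1, 0))" for t
    have \<nu>: "\<nu> 0 = ?r" "(\<nu> has_real_derivative fst x / ?r) (at 0)"
      using d1 by (simp_all only: \<nu>_def [abs_def] scaleR_zero_left add_0_right)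
    have "((\<lambda>t. 1 / \<nu> t ^ N) has_real_derivative
        - (real N * ((fst x / ?r) * ?r ^ (N - 1))) / (?r ^ N * ?r ^ N)) (at 0)"
      using r \<nu> by (auto intro!: derivative_eq_intros)
    also have "- (real N * ((fst x / ?r) * ?r ^ (N - 1))) / (?r ^ N * ?r ^ N) = - real N * fst x / ?r ^ (N + 2)"
      using r by (cases N) (simp_all add: field_simps power_add power2_eq_square)
    finally show ?thesis by (simp only: \<nu>_def)
  qed
  have "((\<lambda>t. (1 / norm (x + t *\<^sub>R (1, 0)) ^ N) *\<^sub>R ((Y + of_real t) ^ p * (X + of_real t) ^ q))
    has_vector_derivative
     (1 / norm (x + 0 *\<^sub>R (1, 0)) ^ N) *\<^sub>R ((Y + of_real 0) ^ p * (real q *\<^sub>R X ^ (q - 1)) + (real p *\<^sub>R Y ^ (p - 1)) * (X + of_real 0) ^ q)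
      + (- real N * fst x / ?r ^ (N + 2)) *\<^sub>R ((Y + of_real 0) ^ p * (X + of_real 0) ^ q)) (at 0)"
    by (intro bounded_bilinear.has_vector_derivative [OF bounded_bilinear_scaleR]
          dn [unfolded has_real_derivative_iff_has_vector_derivative]
          has_vector_derivative_clifford_mult has_vector_derivative_real_shift_power)
  also have "(1 / norm (x + 0 *\<^sub>R (1, 0)) ^ N) *\<^sub>R ((Y + of_real 0) ^ p * (real q *\<^sub>R X ^ (q - 1)) + (real p *\<^sub>R Y ^ (p - 1)) * (X + of_real 0) ^ q)
      + (- real N * fst x / ?r ^ (N + 2)) *\<^sub>R ((Y + of_real 0) ^ p * (X + of_real 0) ^ q) =
     (1 / ?r ^ (N + 2)) *\<^sub>R (real q *\<^sub>R (Y ^ p * (?r\<^sup>2 *\<^sub>R X ^ (q - 1))) + real p *\<^sub>R ((?r\<^sup>2 *\<^sub>R Y ^ (p - 1)) * X ^ q)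
       - (real N / 2) *\<^sub>R (Y ^ p * ((2 * fst x) *\<^sub>R 1) * X ^ q))"
  proof -
    have "x + 0 *\<^sub>R (1, 0) = x" by (simp only: scaleR_zero_left add_0_right)
    moreover have "1 / ?r ^ N = (1 / ?r ^ (N + 2)) * ?r\<^sup>2" using r by (simp add: power_add power2_eq_square)
    ultimately show ?thesis
      by (simp only: of_real_0 add_0_right) (simp add: scaleR_add_right scaleR_diff_right mult_ac)
  qed
  also have "real q *\<^sub>R (Y ^ p * (?r\<^sup>2 *\<^sub>R X ^ (q - 1))) = real q *\<^sub>R (Y ^ Suc p * X ^ q)"
  proof (cases q)
    case (Suc n)
    have "Y ^ p * (?r\<^sup>2 *\<^sub>R X ^ n) = Y ^ p * ((?r\<^sup>2 *\<^sub>R 1) * X ^ n)" by simp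
    also have "\<dots> = Y ^ Suc p * X ^ Suc n"
      unfolding XY [symmetric] comm [symmetric] power_Suc2 [of Y] power_Suc [of X] by (simp only: mult.assoc)
    finally show ?thesis by (simp add: Suc)
  qed simp
  also have "real p *\<^sub>R ((?r\<^sup>2 *\<^sub>R Y ^ (p - 1)) * X ^ q) = real p *\<^sub>R (Y ^ p * X ^ Suc q)"
  proof (cases p)
    case (Suc n)
    have "(?r\<^sup>2 *\<^sub>R Y ^ n) * X ^ q = Y ^ n * (?r\<^sup>2 *\<^sub>R 1) * X ^ q" by simp
    also have "\<dots> = Y ^ Suc n * X ^ Suc q"
      unfolding XY [symmetric] comm [symmetric] power_Suc2 [of Y] power_Suc [of X] by (simp only: mult.assoc)
    finally show ?thesis by (simp add: Suc)
  qed simp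
  also have "Y ^ p * ((2 * fst x) *\<^sub>R 1) * X ^ q = Y ^ p * X ^ Suc q + Y ^ Suc p * X ^ q"
    unfolding X_plus_Y [symmetric] power_Suc2 [of Y] power_Suc [of X] by (simp only: distrib_left distrib_right mult.assoc)
  finally show ?thesis
    unfolding shift shift' by (simp add: scaleR_add_right scaleR_diff_left scaleR_diff_right algebra_simps)
qed

text \<open>
  The function \<open>x^(-a-(n-j)) conj(x)^(-b-j)\<close>, with the fractional powers combined into powers of \<open>|x|\<close>.
\<close>

definition cauchy_deriv_term :: "nat \<Rightarrow> nat \<Rightarrow> 'n::{finite,linorder} point \<Rightarrow> (real, 'n) clifford" where
  "cauchy_deriv_term n j y = (1 / norm y ^ (CARD('n) + 1 + 2 * n)) *\<^sub>R
     (paravector (conj_point y) ^ (n - j + 1) * paravector y ^ j)"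

text \<open>
  Differentiating the term with index \<open>j\<close> lowers one of the two formal exponents: \<open>- b - j\<close>, which leads to the
  index \<open>j + 1\<close>, or \<open>- a - (n - j)\<close>, which keeps the index.
\<close>

lemma higher_partial_x0_cauchy_kernel:
  fixes y :: "'n::{finite,linorder} point"
  defines "b \<equiv> (real CARD('n) - 1) / 2"
  assumes "y \<noteq> 0"
  shows "(partial_x0 ^^ n) (\<lambda>y. (1 / norm y ^ (CARD('n) + 1)) *\<^sub>R paravector (conj_point y)) y =
    ((- 1) ^ n) *\<^sub>R (\<Sum>j\<le>n. vandermonde_term (b + 1) b n j *\<^sub>R cauchy_deriv_term n j y)"
  using assms(2)
proof (induction n arbitrary: y)
  case 0
  then show ?case by (simp add: cauchy_deriv_term_def vandermonde_term_def)
next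
  case (Suc n)
  let ?c = "vandermonde_term (b + 1) b" and ?U = "cauchy_deriv_term :: nat \<Rightarrow> nat \<Rightarrow> 'n point \<Rightarrow> _"
  let ?h = "\<lambda>y :: 'n point. (1 / norm y ^ (CARD('n) + 1)) *\<^sub>R paravector (conj_point y) :: (real, 'n) clifford"
  have dU: "((\<lambda>t. ?U n j (y + t *\<^sub>R (1, 0))) has_vector_derivative
      - ((b + real j) *\<^sub>R ?U (Suc n) (Suc j) y + (b + 1 + real (n - j)) *\<^sub>R ?U (Suc n) j y)) (at 0)"
    if "j \<le> n" for j
  proof -
    let ?N = "CARD('n) + 1 + 2 * n"
    have c1: "real (n - j + 1) - real ?N / 2 = - (b + real j)"
      and c2: "real j - real ?N / 2 = - (b + 1 + real (n - j))"
      using that by (simp_all add: b_def of_nat_diff field_simps)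
    have e: "Suc n - Suc j + 1 = n - j + 1" "Suc n - j + 1 = Suc (n - j + 1)"
      "CARD('n) + 1 + 2 * Suc n = ?N + 2"
      using that by auto
    have alg: "c *\<^sub>R (- u *\<^sub>R P + - w *\<^sub>R Q) = - (u *\<^sub>R c *\<^sub>R P + w *\<^sub>R c *\<^sub>R Q)"
      for c u w and P Q :: "(real, 'n) clifford"
      by (simp add: scaleR_diff_right mult.commute)
    show ?thesis
      using partial_x0_axial_term [OF Suc.prems, of ?N "n - j + 1" j]
      unfolding c1 c2 cauchy_deriv_term_def e
      unfolding alg .
  qed
  have "((\<lambda>t. (- 1) ^ n *\<^sub>R (\<Sum>j\<le>n. ?c n j *\<^sub>R ?U n j (y + t *\<^sub>R (1, 0)))) has_vector_derivative
      (- 1) ^ n *\<^sub>R (\<Sum>j\<le>n. ?c n j *\<^sub>R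
        - ((b + real j) *\<^sub>R ?U (Suc n) (Suc j) y + (b + 1 + real (n - j)) *\<^sub>R ?U (Suc n) j y))) (at 0)"
    using dU by (intro bounded_linear.has_vector_derivative [OF bounded_linear_scaleR_right] has_vector_derivative_sum) auto
  also have "(\<Sum>j\<le>n. ?c n j *\<^sub>R
        - ((b + real j) *\<^sub>R ?U (Suc n) (Suc j) y + (b + 1 + real (n - j)) *\<^sub>R ?U (Suc n) j y)) =
      - (\<Sum>j\<le>Suc n. ?c (Suc n) j *\<^sub>R ?U (Suc n) j y)"
    using vandermonde_term_step [of "b + 1" b n "\<lambda>j. ?U (Suc n) j y"] by (simp only: scaleR_minus_right sum_negf)
  finally have deriv: "((\<lambda>t. (- 1) ^ n *\<^sub>R (\<Sum>j\<le>n. ?c n j *\<^sub>R ?U n j (y + t *\<^sub>R (1, 0)))) has_vector_derivative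
      (- 1) ^ Suc n *\<^sub>R (\<Sum>j\<le>Suc n. ?c (Suc n) j *\<^sub>R ?U (Suc n) j y)) (at 0)"
    by (simp only: power_Suc mult_minus1 scaleR_minus_left scaleR_minus_right)
  have "\<forall>\<^sub>F t in nhds (0::real). y + t *\<^sub>R (1, 0) \<noteq> 0"
  proof (rule eventually_nhds_in_open [THEN eventually_mono])
    show "open {t. y + t *\<^sub>R (1, 0) \<noteq> 0}"
      by (intro open_Collect_neq continuous_intros)
    show "0 \<in> {t. y + t *\<^sub>R (1, 0) \<noteq> 0}"
      using Suc.prems by (simp only: mem_Collect_eq scaleR_zero_left add_0_right not_False_eq_True)
  qed simp
  \<comment> \<open>The formula for the lower derivative holds only off the origin, which suffices to differentiate it there.\<close>
  then have ev: "\<forall>\<^sub>F t in nhds 0. (- 1) ^ n *\<^sub>R (\<Sum>j\<le>n. ?c n j *\<^sub>R ?U n j (y + t *\<^sub>R (1, 0))) =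
      (partial_x0 ^^ n) ?h (y + t *\<^sub>R (1, 0))"
    by eventually_elim (rule Suc.IH [symmetric])
  have "((\<lambda>t. (partial_x0 ^^ n) ?h (y + t *\<^sub>R (1, 0))) has_vector_derivative
      (- 1) ^ Suc n *\<^sub>R (\<Sum>j\<le>Suc n. ?c (Suc n) j *\<^sub>R ?U (Suc n) j y)) (at 0)"
    by (rule has_vector_derivative_cong_ev [THEN iffD1, OF _ _ deriv])
       (use ev eventually_nhds_x_imp_x [OF ev] in \<open>auto elim: eventually_mono\<close>)
  then have "partial_x0 ((partial_x0 ^^ n) ?h) y =
      (- 1) ^ Suc n *\<^sub>R (\<Sum>j\<le>Suc n. ?c (Suc n) j *\<^sub>R ?U (Suc n) j y)"
    unfolding partial_deriv_def [of "(1, 0)" "(partial_x0 ^^ n) ?h" y] by (rule vector_derivative_at)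
  then show ?case by (simp only: funpow.simps o_apply)
qed

text \<open>
  At the inverse point \<open>y = x\<^sup>-\<^sup>1\<close> the paravectors \<open>y\<close> and \<open>conj(y)\<close> are \<open>conj(x) / |x|\<^sup>2\<close> and \<open>x / |x|\<^sup>2\<close>, so each
  term of the derivative becomes \<open>x^(k-j) conj(x)^j\<close> times \<open>x |x|^(m-1)\<close>, and the latter is cancelled by the
  factor \<open>conj(x) / |x|^(m+1)\<close> of the inversion.
\<close>

lemma kelvin_P_neg:
  fixes x :: "'n::{finite,linorder} point"
  assumes "x \<noteq> 0"
  shows "kelvin (P_neg (k + 1)) x =
    (lambda_const CARD('n) * pochhammer (real CARD('n)) k / fact k) *\<^sub>R Q_poly k x"
proof -
  let ?b = "(real CARD('n) - 1) / 2" and ?m = "CARD('n)" and ?r = "norm x"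
  let ?X = "paravector x :: (real, 'n) clifford" and ?Y = "paravector (conj_point x) :: (real, 'n) clifford"
  have r: "?r > 0" using assms by simp
  define y where "y = inv_point x"
  have y: "paravector y = (1 / ?r\<^sup>2) *\<^sub>R ?Y"
    by (simp add: y_def inv_point_def linear_scale [OF linear_paravector])
  have y': "paravector (conj_point y) = (1 / ?r\<^sup>2) *\<^sub>R ?X"
    by (simp add: y_def inv_point_def conj_point_scaleR linear_scale [OF linear_paravector])
  have norm_y: "norm y = 1 / ?r" using r by (simp add: y_def inv_point_def power2_eq_square)
  have "y \<noteq> 0" using norm_y r by auto
  have YX: "?Y * ?X = ?r\<^sup>2 *\<^sub>R 1"
    by (simp add: paravector_mult_conj_commute paravector_mult_conj of_real_def)
  have "(1 / ?r ^ (?m + 1)) *\<^sub>R (?Y * cauchy_deriv_term k j y) = ?X ^ (k - j) * ?Y ^ j" if "j \<le> k" for j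
  proof -
    have "?Y * cauchy_deriv_term k j y = (?r ^ (?m + 1 + 2 * k) * ((1 / ?r\<^sup>2) ^ (k - j + 1) * (1 / ?r\<^sup>2) ^ j)) *\<^sub>R
       ((?Y * ?X) * (?X ^ (k - j) * ?Y ^ j))"
      by (simp add: cauchy_deriv_term_def y y' norm_y power_scaleR_clifford power_one_over mult.assoc)
    also have "(1 / ?r\<^sup>2) ^ (k - j + 1) * (1 / ?r\<^sup>2) ^ j = (1 / ?r\<^sup>2) ^ (k + 1)"
      using that by (simp add: power_add [symmetric])
    also have "\<dots> = 1 / (?r ^ (2 * k) * ?r\<^sup>2)"
      by (simp add: power_one_over power_mult [symmetric] power_add [symmetric])
    finally show ?thesis
      using r by (simp add: YX power_add field_simps)
  qed
  note cancel = this
  have scaled: "(1 / ?r ^ (?m + 1)) *\<^sub>R (?Y * (c *\<^sub>R cauchy_deriv_term k j y)) = c *\<^sub>R (?X ^ (k - j) * ?Y ^ j)"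
    if "j \<le> k" for j c
  proof -
    have "(1 / ?r ^ (?m + 1)) *\<^sub>R (?Y * (c *\<^sub>R cauchy_deriv_term k j y)) =
        c *\<^sub>R ((1 / ?r ^ (?m + 1)) *\<^sub>R (?Y * cauchy_deriv_term k j y))"
      by (simp add: mult.commute)
    with that show ?thesis by (simp only: cancel)
  qed
  have sign: "((- 1) ^ k * lambda_const ?m / fact k) *\<^sub>R ((- 1) ^ k *\<^sub>R a) = (lambda_const ?m / fact k) *\<^sub>R a"
    for a :: "(real, 'n) clifford"
    by (simp add: power_mult_distrib [symmetric])
  have P: "P_neg (k + 1) y = (lambda_const ?m / fact k) *\<^sub>R
      (\<Sum>j\<le>k. vandermonde_term (?b + 1) ?b k j *\<^sub>R cauchy_deriv_term k j y)"
    unfolding P_neg_def add_diff_cancel_right' higher_partial_x0_cauchy_kernel [OF \<open>y \<noteq> 0\<close>] by (rule sign)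
  have "kelvin (P_neg (k + 1)) x = (lambda_const ?m / fact k) *\<^sub>R
      (\<Sum>j\<le>k. (1 / ?r ^ (?m + 1)) *\<^sub>R (?Y * (vandermonde_term (?b + 1) ?b k j *\<^sub>R cauchy_deriv_term k j y)))"
    unfolding kelvin_def y_def [symmetric] P
    by (simp add: sum_distrib_left scaleR_sum_right mult_ac)
  also have "\<dots> = (lambda_const ?m / fact k) *\<^sub>R
      (\<Sum>j\<le>k. vandermonde_term (?b + 1) ?b k j *\<^sub>R (?X ^ (k - j) * ?Y ^ j))"
    by (intro arg_cong [of _ _ "\<lambda>a. _ *\<^sub>R a"] sum.cong refl) (simp only: scaled atMost_iff)
  also have "\<dots> = (lambda_const ?m / fact k) *\<^sub>R (pochhammer (real ?m) k *\<^sub>R Q_poly k x)"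
    unfolding Q_poly_binomial_sum ..
  finally show ?thesis by simp
qed

section \<open>The Fueter-Sce-Qian image of a power\<close>

lemma clifford_scale_complexify_scaleR: "c *\<^sub>K complexify (r *\<^sub>R a) = (c * of_real r) *\<^sub>K complexify a"
  by transfer (simp add: vec_eq_iff)

lemma linear_clifford_scale_complexify: "linear (\<lambda>a. c *\<^sub>K complexify a)"
  by (rule linearI; transfer; simp add: vec_eq_iff algebra_simps scaleR_conv_of_real [where 'a = complex])

lemma clifford_mult_scale_right:
  "a * (c *\<^sub>K b) = c *\<^sub>K (a * b :: ('k::real_normed_field, 'n::{finite,linorder}) clifford)"
  by transfer (simp add: vec_eq_iff sum_distrib_left mult_ac)

lemma complexify_mult:
  "complexify (a * b :: (real, 'n::{finite,linorder}) clifford) = complexify a * complexify b"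
proof -
  have "complex_of_real (clifford_sign A B) = clifford_sign A B" for A B :: "'n set"
    by (simp add: clifford_sign_def if_distrib of_real_prod cong: if_cong)
  then show ?thesis by transfer (simp add: vec_eq_iff)
qed

lemma complexify_paravector: "complexify (paravector x) = (paravector x :: (complex, 'n::{finite,linorder}) clifford)"
proof -
  have lin: "linear (complexify :: (real, 'n) clifford \<Rightarrow> _)"
    by (rule linearI; transfer; simp add: vec_eq_iff scaleR_conv_of_real [where 'a = complex])
  have one: "complexify (1 :: (real, 'n) clifford) = 1"
    by transfer (simp add: vec_eq_iff)
  have basis: "complexify (clifford_basis A :: (real, 'n) clifford) = clifford_basis A" for A
    by transfer (simp add: vec_eq_iff axis_def)
  show ?thesis
    by (simp add: paravector_def of_real_def linear_add [OF lin] linear_sum [OF lin] linear_scale [OF lin] one basis)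
qed

text \<open>
  The inversion multiplies by real paravectors, with which the complex scalar \<open>(-1)^((1-m)/2)\<close> commutes; this
  reduces the complexified inversion to the real one.
\<close>

lemma kelvin_frac_Laplace:
  fixes x :: "'n::{finite,linorder} point"
  shows "kelvin (frac_Laplace_inv_power n) x = sign_const CARD('n) *\<^sub>K complexify (kelvin (P_neg n) x)"
proof -
  have s: "r *\<^sub>R (c *\<^sub>K b) = c *\<^sub>K (r *\<^sub>R b)" for r c and b :: "(complex, 'n) clifford"
    by transfer (simp add: vec_eq_iff)
  have lin: "complexify (r *\<^sub>R b) = r *\<^sub>R complexify b" for r and b :: "(real, 'n) clifford"
    by transfer (simp add: vec_eq_iff scaleR_conv_of_real [where 'a = complex])
  show ?thesis
    unfolding kelvin_def frac_Laplace_inv_power_def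
    by (simp add: clifford_mult_scale_right complexify_mult complexify_paravector lin s)
qed

lemma continuous_Q_poly:
  "continuous (at x) (Q_poly k :: 'n::{finite,linorder} point \<Rightarrow> _)"
proof -
  have pow: "continuous (at x) (\<lambda>x. f x ^ n)" if "continuous (at x) f" for f :: "'n point \<Rightarrow> (real, 'n) clifford" and n
    by (induction n) (auto intro!: bounded_bilinear.continuous [OF bounded_bilinear_clifford_mult] that)
  have p: "continuous (at x) (paravector :: 'n point \<Rightarrow> (real, 'n) clifford)"
    by (rule linear_continuous_at [OF bounded_linear_paravector])
  have c: "continuous (at x) (\<lambda>x :: 'n point. paravector (conj_point x) :: (real, 'n) clifford)"
    by (rule bounded_linear.continuous [OF bounded_linear_paravector])
       (auto simp: conj_point_def intro!: continuous_intros)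
  show ?thesis
    unfolding Q_poly_def
    by (intro continuous_sum continuous_scaleR continuous_const
          bounded_bilinear.continuous [OF bounded_bilinear_clifford_mult] pow p c)
qed

text \<open>
  Off the origin the Kelvin inversion is a multiple of \<open>Q\<^sub>k\<close>; by continuity of \<open>Q\<^sub>k\<close> the limit that fills
  the removable singularity is the value of the same polynomial.
\<close>

lemma FSQ_eq_Q_poly:
  "FSQ (CARD('n) - 1 + k) =
    (\<lambda>x :: 'n::{finite,linorder} point. (sign_const CARD('n) *
       of_real (lambda_const CARD('n) * pochhammer (real CARD('n)) k / fact k)) *\<^sub>K complexify (Q_poly k x))"
proof -
  define L where "L = (\<lambda>a :: (real, 'n) clifford. (sign_const CARD('n) *
       of_real (lambda_const CARD('n) * pochhammer (real CARD('n)) k / fact k)) *\<^sub>K complexify a)"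
  define g where "g = (kelvin (frac_Laplace_inv_power (k + 1)) :: 'n point \<Rightarrow> (complex, 'n) clifford)"
  have g: "g x = L (Q_poly k x)" if "x \<noteq> 0" for x
    unfolding g_def L_def kelvin_frac_Laplace kelvin_P_neg [OF that] clifford_scale_complexify_scaleR ..
  have "continuous (at 0) (\<lambda>x. L (Q_poly k x))"
    unfolding L_def
    by (rule bounded_linear.continuous [OF bounded_linear_clifford [OF linear_clifford_scale_complexify] continuous_Q_poly])
  then have "((\<lambda>x. L (Q_poly k x)) \<longlongrightarrow> L (Q_poly k 0)) (at (0 :: 'n point))"
    by (simp add: continuous_at)
  then have "(g \<longlongrightarrow> L (Q_poly k 0)) (at 0)"
    by (rule Lim_transform_eventually) (auto simp: eventually_at_filter g)
  then have "Lim (at 0) g = L (Q_poly k 0)"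
    by (intro tendsto_Lim) simp_all
  then have "g(0 := Lim (at 0) g) = (\<lambda>x. L (Q_poly k x))"
    using g by (auto simp: fun_eq_iff)
  moreover have "CARD('n) - 1 + k + 2 - CARD('n) = k + 1" "\<not> CARD('n) - 1 + k < CARD('n) - 1"
    using zero_less_card_finite [where 'a = 'n] by linarith+
  ultimately show ?thesis
    unfolding FSQ_def L_def g_def by (simp only: Let_def if_False)
qed

lemma pochhammer_of_nat_fact:
  assumes "m > 0"
  shows "pochhammer (real m) k * fact (m - 1) = fact (m - 1 + k)"
proof -
  obtain n where m: "m = Suc n" using assms by (cases m) auto
  have "pochhammer (real (Suc n)) k * fact n = fact (n + k)"
  proof (induction k)
    case (Suc k)
    have "fact (n + Suc k) = (real (Suc n) + real k) * fact (n + k)" by simp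
    then show ?case unfolding Suc.IH [symmetric] pochhammer_Suc by (simp only: mult_ac)
  qed simp
  then show ?thesis by (simp add: m)
qed

lemma gamma_const_conv_lambda_const:
  assumes "m > 0"
  shows "sign_const m * of_real (lambda_const m * pochhammer (real m) k / fact k) =
    gamma_const m * (fact (m - 1 + k) / fact k)"
proof -
  have "complex_of_real (pochhammer (real m) k) * fact (m - 1) = fact (m - 1 + k)"
    using arg_cong [OF pochhammer_of_nat_fact [OF assms, of k], of complex_of_real] by simp
  then show ?thesis
    by (simp add: gamma_const_def lambda_const_def divide_simps mult_ac)
qed

theorem corollary4p9:
  fixes m k :: nat
  assumes m: "CARD('n::{finite,linorder}) = m"
  shows "(FSQ (m - 1 + k) :: 'n point \<Rightarrow> (complex, 'n) clifford) =
           (\<lambda>x. gamma_const m *\<^sub>K complexify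
              (GCK ((deriv_op ^^ (m - 1)) (\<lambda>t. of_real (t ^ (m - 1 + k)))) x))
       \<and> (\<lambda>x :: 'n point. gamma_const m *\<^sub>K complexify
              (GCK ((deriv_op ^^ (m - 1)) (\<lambda>t. of_real (t ^ (m - 1 + k)))) x)) =
           (\<lambda>x. (gamma_const m * (fact (m - 1 + k) / fact k)) *\<^sub>K complexify (Q_poly k x))"
proof
  have "m > 0" using m zero_less_card_finite [where 'a = 'n] by simp
  have GCK: "gamma_const m *\<^sub>K complexify (GCK ((deriv_op ^^ (m - 1)) (\<lambda>t. of_real (t ^ (m - 1 + k)))) x) =
      (gamma_const m * (fact (m - 1 + k) / fact k)) *\<^sub>K complexify (Q_poly k x)" for x :: "'n point"
    unfolding higher_deriv_monomial GCK_Q_poly clifford_scale_complexify_scaleR by simp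
  then show "(\<lambda>x :: 'n point. gamma_const m *\<^sub>K complexify
              (GCK ((deriv_op ^^ (m - 1)) (\<lambda>t. of_real (t ^ (m - 1 + k)))) x)) =
           (\<lambda>x. (gamma_const m * (fact (m - 1 + k) / fact k)) *\<^sub>K complexify (Q_poly k x))"
    by (rule ext)
  show "(FSQ (m - 1 + k) :: 'n point \<Rightarrow> (complex, 'n) clifford) =
           (\<lambda>x. gamma_const m *\<^sub>K complexify
              (GCK ((deriv_op ^^ (m - 1)) (\<lambda>t. of_real (t ^ (m - 1 + k)))) x))"
    unfolding GCK
    using FSQ_eq_Q_poly [where 'n = 'n, of k]
    unfolding m gamma_const_conv_lambda_const [OF \<open>m > 0\<close>] .
qed

end
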